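(* Let $Q_0:\mathcal M\to\mathcal M$ be a map and $\alpha\in(0,1)$ a constant such that: (i) if $u_k\in\mathcal M$ converge to $u\in\mathcal M$ uniformly on every bounded interval, then $Q_0[u_k]\to Q_0[u]$ almost everywhere; (ii) $u_1\le u_2$ (pointwise) implies $Q_0[u_1]\le Q_0[u_2]$ for all $u_1,u_2\in\mathcal M$; (iii) $T_{x_0}Q_0=Q_0T_{x_0}$ for all $x_0\in\mathbb R$, where $(T_{x_0}[u])(\cdot)=u(\cdot-x_0)$; (iv) $Q_0[\alpha]=\alpha$, and for constant functions $\gamma$: $0<\gamma<\alpha$ implies $Q_0[\gamma]<\gamma$, and $\alpha<\gamma<1$ implies $\gamma<Q_0[\gamma]$; (v) whenever constants $c_-,c_+$ and $\phi_-,\phi_+\in\mathcal M$ satisfy $(Q_0[\phi_-])(x-c_-)\equiv\phi_-(x)$, $\phi_-(-\infty)=0$, $\phi_-(+\infty)=\alpha$, $(Q_0[\phi_+])(x-c_+)\equiv\phi_+(x)$, $\phi_+(-\infty)=\alpha$, $\phi_+(+\infty)=1$, one has $c_-<c_+$. Suppose a constant $\underline c$ and $\underline\psi\in\mathcal M$ with $\underline\psi(0)=0$ and $\underline\psi(+\infty)\in(\alpha,1]$ satisfy $\underline\psi(x)\le(Q_0[\underline\psi])(x-\underline c)$ for all $x$, and a constant $\overline c$ and $\overline\psi\in\mathcal M$ with $\overline\psi(-\infty)\in[0,\alpha)$ and $\overline\psi(0)=1$ satisfy $(Q_0[\overline\psi])(x-\overline c)\le\overline\psi(x)$ for all $x$.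 Then there exist $c\in[\underline c,\overline c]$ and $\phi\in\mathcal M$ with $\phi(-\infty)=0$, $\phi(+\infty)=1$ such that $(Q_0[\phi])(x-c)\equiv\phi(x)$.
   Context: $\mathcal M$ denotes the set of monotone nondecreasing, left continuous functions $u$ on $\mathbb R$ with $0\le u\le 1$. Constants are regarded as constant functions in $\mathcal M$. *)

theory Defs
  imports "HOL-Analysis.Analysis"
begin

definition classM :: "(real \<Rightarrow> real) set" where
  "classM = {u. mono u \<and> (\<forall>x. continuous (at_left x) u) \<and> (\<forall>x. 0 \<le> u x \<and> u x \<le> 1)}"

definition shiftT :: "real \<Rightarrow> (real \<Rightarrow> real) \<Rightarrow> (real \<Rightarrow> real)" where
  "shiftT x0 u = (\<lambda>y. u (y - x0))"

definition unif_conv_bounded :: "(nat \<Rightarrow> real \<Rightarrow> real) \<Rightarrow> (real \<Rightarrow> real) \<Rightarrow> bool" where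
  "unif_conv_bounded us u \<longleftrightarrow>
     (\<forall>a b. \<forall>e>0. \<forall>\<^sub>F k in sequentially. \<forall>x\<in>{a..b}. \<bar>us k x - u x\<bar> < e)"

end

theory Submission
  imports Defs "HOL-Probability.Helly_Selection"
begin

text \<open>
  Translation invariance upgrades the continuity hypothesis to continuity for convergence at all
  continuity points, under which the monotone functions are sequentially compact.  For a speed
  \<open>c\<close> write \<open>Q\<^sub>c u (x) = Q u (x - c)\<close>, and truncate: prescribe the values \<open>0\<close> on
  \<open>(-\<infinity>, -N]\<close> and \<open>1\<close> on \<open>(N, \<infinity>)\<close>, and let \<open>u = Q\<^sub>c u\<close> in between.
  The truncated problem is solvable for every \<open>c\<close> by Tarski's theorem.  For a level
  \<open>b\<close> above \<open>\<alpha>\<close>, some solution at the lower speed exceeds \<open>b\<close> at the origin (it lies above the given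
  subsolution) and some solution at the upper speed does not, so there are solutions of both kinds
  at arbitrarily close speeds.  Let \<open>N \<rightarrow> \<infinity>\<close>, with both speeds tending to \<open>c\<close>.

  The distance between a level below \<open>\<alpha>\<close> and the level \<open>b\<close> stays bounded: otherwise one
  limit is a subsolution from \<open>0\<close> to \<open>\<alpha>\<close>, another a supersolution from \<open>\<alpha>\<close> to \<open>1\<close>, each of these
  gives a wave of the same speed \<open>c\<close>, and hypothesis (v) is violated.  Hence the first family has a
  limit joining \<open>0\<close> to \<open>1\<close> that is a wave or a subsolution vanishing on a left half-line, and the
  second a limit that is a wave or a supersolution equal to \<open>1\<close> on a right half-line.  In
  the remaining case translation orders the two, and Tarski's theorem gives a wave between them.
\<close>

section \<open>Monotone left continuous functions\<close>

text \<open>For a monotone function left continuity at \<open>x\<close> only asks that values from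
  the left come within \<open>e\<close> below \<open>u x\<close>; the other half of the limit is
  monotonicity. This form is the one checked in the closure lemmas that follow.\<close>

lemma classM_iff:
  "u \<in> classM \<longleftrightarrow> mono u \<and> (\<forall>x. 0 \<le> u x \<and> u x \<le> 1) \<and> (\<forall>x. \<forall>e>0. \<exists>y<x. u x - e < u y)"
proof -
  have *: "(\<forall>x. continuous (at_left x) u) \<longleftrightarrow> (\<forall>x. \<forall>e>0. \<exists>y<x. u x - e < u y)" if m: "mono u"
  proof (intro iffI allI impI)
    fix x e :: real assume c: "\<forall>x. continuous (at_left x) u" and e: "e > 0"
    have "(u \<longlongrightarrow> u x) (at_left x)" using c by (simp add: continuous_within)
    then have "\<forall>\<^sub>F y in at_left x. u x - e < u y" by (rule order_tendstoD) (use e in simp)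
    then obtain b where b: "b < x" "\<And>y. b < y \<Longrightarrow> y < x \<Longrightarrow> u x - e < u y"
      using eventually_at_left[of "x - 1" x] by auto
    then show "\<exists>y<x. u x - e < u y" using dense[OF b(1)] by blast
  next
    fix x assume l: "\<forall>x. \<forall>e>0. \<exists>y<x. u x - e < u y"
    have "(u \<longlongrightarrow> u x) (at_left x)"
    proof (rule order_tendstoI)
      fix a assume "a < u x"
      then obtain y where y: "y < x" "u x - (u x - a) < u y" using l[rule_format, of "u x - a" x] by auto
      have "a < u z" if "y < z" for z using y monoD[OF m, of y z] that by auto
      then show "\<forall>\<^sub>F z in at_left x. a < u z" using y(1) eventually_at_left[of "x - 1" x] by auto
    next
      fix a assume "u x < a"
      then have "u z < a" if "z < x" for z using monoD[OF m, of z x] that by auto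
      then show "\<forall>\<^sub>F z in at_left x. u z < a" by (auto simp: eventually_at_filter)
    qed
    then show "continuous (at_left x) u" by (simp add: continuous_within)
  qed
  show ?thesis unfolding classM_def mem_Collect_eq
    by (rule conj_cong[OF refl]) (subst conj_commute, rule conj_cong[OF refl *])
qed

lemma classM_mono: "u \<in> classM \<Longrightarrow> x \<le> y \<Longrightarrow> u x \<le> u y"
  by (auto simp: classM_def mono_def)

lemma classM_nonneg: "u \<in> classM \<Longrightarrow> 0 \<le> u x"
  and classM_le_1: "u \<in> classM \<Longrightarrow> u x \<le> 1"
  by (auto simp: classM_def)

lemma classM_left: "u \<in> classM \<Longrightarrow> e > 0 \<Longrightarrow> \<exists>y<x. u x - e < u y"
  by (auto simp: classM_iff)

lemma classM_const: "0 \<le> a \<Longrightarrow> a \<le> 1 \<Longrightarrow> (\<lambda>_. a) \<in> classM"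
  by (auto simp: classM_iff mono_def intro: lt_ex)

lemma classM_shift: "u \<in> classM \<Longrightarrow> shiftT a u \<in> classM"
proof -
  assume u: "u \<in> classM"
  have "\<exists>y<x. u (x - a) - e < u (y - a)" if e: "e > 0" for x e
  proof -
    obtain y where "y < x - a" "u (x - a) - e < u y" using classM_left[OF u e] by blast
    then show ?thesis by (intro exI[of _ "y + a"]) auto
  qed
  then show ?thesis
    using u by (auto simp: classM_iff shiftT_def mono_def)
qed

lemma classM_max: "u \<in> classM \<Longrightarrow> v \<in> classM \<Longrightarrow> (\<lambda>x. max (u x) (v x)) \<in> classM"
proof -
  assume u: "u \<in> classM" and v: "v \<in> classM"
  have "\<exists>y<x. max (u x) (v x) - e < max (u y) (v y)" if "e > 0" for x e
  proof (cases "u x \<le> v x")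
    case True
    then show ?thesis using classM_left[OF v that, of x] by (auto simp: less_max_iff_disj)
  next
    case False
    then show ?thesis using classM_left[OF u that, of x] by (auto simp: less_max_iff_disj)
  qed
  moreover have "max (u x) (v x) \<le> max (u y) (v y)" if "x \<le> y" for x y
    using classM_mono[OF u that] classM_mono[OF v that] by auto
  ultimately show ?thesis using u v by (auto simp: classM_iff mono_def le_max_iff_disj)
qed

lemma classM_min:
  assumes "u \<in> classM" "v \<in> classM" shows "(\<lambda>x. min (u x) (v x)) \<in> classM"
proof -
  have "\<exists>y<x. min (u x) (v x) - e < min (u y) (v y)" if "e > 0" for x e
  proof -
    obtain y z where "y < x" "u x - e < u y" "z < x" "v x - e < v z"
      using classM_left assms \<open>e > 0\<close> by metis
    then show ?thesis
      using classM_mono[OF assms(1), of y "max y z"] classM_mono[OF assms(2), of z "max y z"]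
      by (intro exI[of _ "max y z"]) auto
  qed
  moreover have "min (u x) (v x) \<le> min (u y) (v y)" if "x \<le> y" for x y
    using classM_mono[OF assms(1) that] classM_mono[OF assms(2) that] by auto
  ultimately show ?thesis using assms by (auto simp: classM_iff mono_def min_le_iff_disj)
qed

lemma classM_step:
  assumes "0 \<le> a" "a \<le> b" "b \<le> 1"
  shows "(\<lambda>x. if x \<le> t then a else b) \<in> classM"
proof -
  have "\<exists>y<x. (if x \<le> t then a else b) - e < (if y \<le> t then a else b)" if "e > 0" for x e :: real
  proof (cases "x \<le> t")
    case True
    then show ?thesis using that by (intro exI[of _ "x - 1"]) auto
  next
    case False
    then show ?thesis using that dense[of t x] by force
  qed
  then show ?thesis using assms by (auto simp: classM_iff mono_def)
qed

text \<open>A function of the family that is nearly maximal at \<open>x\<close> is still nearly as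
  large slightly to the left of \<open>x\<close>, so left continuity survives suprema. It need not
  survive infima, which is why fixed points are built from below.\<close>

lemma classM_SUP:
  assumes S: "S \<subseteq> classM" "S \<noteq> {}"
  shows "(\<lambda>x. SUP u\<in>S. u x) \<in> classM"
proof -
  have bdd: "bdd_above ((\<lambda>u. u x) ` S)" for x
    using S classM_le_1 by (intro bdd_aboveI2[of _ _ 1]) auto
  have up: "u x \<le> (SUP u\<in>S. u x)" if "u \<in> S" for u x using that bdd by (rule cSUP_upper)
  have 1: "(SUP u\<in>S. u x) \<le> (SUP u\<in>S. u y)" if "x \<le> y" for x y
    by (rule cSUP_least[OF S(2)]) (metis S(1) classM_mono in_mono order_trans that up)
  have 2: "\<exists>y<x. (SUP u\<in>S. u x) - e < (SUP u\<in>S. u y)" if "e > 0" for x e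
  proof -
    obtain u where u: "u \<in> S" "(SUP u\<in>S. u x) - e/2 < u x"
      using less_cSUP_iff[OF S(2) bdd, of "(SUP u\<in>S. u x) - e/2" x] \<open>e > 0\<close> by auto
    obtain y where "y < x" "u x - e/2 < u y" using classM_left[of u "e/2" x] u S \<open>e > 0\<close> by auto
    then show ?thesis using u up[OF u(1), of y] by (intro exI[of _ y]) auto
  qed
  obtain u where u: "u \<in> S" using S by auto
  have "0 \<le> (SUP u\<in>S. u x)" for x using up[OF u, of x] classM_nonneg[of u x] u S by auto
  moreover have "(SUP u\<in>S. u x) \<le> 1" for x
    by (rule cSUP_least[OF S(2)]) (use S classM_le_1 in auto)
  ultimately show ?thesis using 1 2 by (auto simp: classM_iff mono_def)
qed

text \<open>Tarski's argument: the supremum \<open>w\<close> of all \<open>u \<le> G u\<close>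
  between \<open>p\<close> and \<open>q\<close> is fixed. It serves for the obstacle problems, the
  truncated problems and the final squeeze between two profiles.\<close>

lemma classM_fixed_point:
  assumes G: "\<And>u. u \<in> classM \<Longrightarrow> G u \<in> classM"
    and mono: "\<And>u v. u \<in> classM \<Longrightarrow> v \<in> classM \<Longrightarrow> u \<le> v \<Longrightarrow> G u \<le> G v"
    and p: "p \<in> classM" "p \<le> G p" and q: "q \<in> classM" "G q \<le> q" and pq: "p \<le> q"
  obtains u where "u \<in> classM" "p \<le> u" "u \<le> q" "G u = u"
proof -
  define S where "S = {u \<in> classM. p \<le> u \<and> u \<le> q \<and> u \<le> G u}"
  define w where "w = (\<lambda>x. SUP u\<in>S. u x)"
  have S: "S \<subseteq> classM" "S \<noteq> {}" using p pq by (auto simp: S_def)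
  have bdd: "bdd_above ((\<lambda>u. u x) ` S)" for x
    using S classM_le_1 by (intro bdd_aboveI2[of _ _ 1]) auto
  have w: "w \<in> classM" unfolding w_def by (rule classM_SUP[OF S])
  have up: "u \<le> w" if "u \<in> S" for u
    unfolding w_def le_fun_def using that bdd by (auto intro: cSUP_upper)
  have least: "w \<le> v" if "\<And>u. u \<in> S \<Longrightarrow> u \<le> v" for v
    unfolding w_def le_fun_def using that by (auto intro!: cSUP_least[OF S(2)] simp: le_fun_def)
  have pw: "p \<le> w" by (rule up) (use p pq in \<open>auto simp: S_def\<close>)
  have wq: "w \<le> q" by (rule least) (auto simp: S_def)
  have wG: "w \<le> G w"
  proof (rule least)
    fix u assume u: "u \<in> S"
    then have "u \<le> G u" by (auto simp: S_def)
    also have "\<dots> \<le> G w" by (rule mono) (use u up w in \<open>auto simp: S_def\<close>)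
    finally show "u \<le> G w" .
  qed
  \<comment> \<open>\<open>G w\<close> competes in the supremum that defines \<open>w\<close>, hence
    lies below \<open>w\<close>.\<close>
  have "G w \<in> S" unfolding S_def
    using G w mono[OF w G[OF w] wG] pw wG mono[OF w q(1) wq] q(2) by (auto intro: order_trans)
  then have "G w = w" using up wG by (auto intro: antisym)
  then show thesis using that w pw wq by blast
qed

lemma classM_level:
  assumes u: "u \<in> classM" and p: "u p \<le> b" and q: "b < u q"
  obtains z where "u z \<le> b" "\<And>x. z < x \<Longrightarrow> b < u x"
proof -
  define A where "A = {x. u x \<le> b}"
  have ne: "A \<noteq> {}" using p by (auto simp: A_def)
  have "x \<le> q" if "x \<in> A" for x using that q classM_mono[OF u, of q x] by (force simp: A_def)
  then have bdd: "bdd_above A" by (auto simp: bdd_above_def)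
  \<comment> \<open>Left continuity puts the supremum of the sublevel set into the set
    itself.\<close>
  have "u (Sup A) \<le> b"
  proof (rule ccontr)
    assume "\<not> u (Sup A) \<le> b"
    then obtain y where y: "y < Sup A" "u (Sup A) - (u (Sup A) - b) < u y"
      using classM_left[OF u, of "u (Sup A) - b" "Sup A"] by auto
    then obtain x where "x \<in> A" "y < x" using less_cSup_iff[OF ne bdd] by auto
    then show False using y classM_mono[OF u, of y x] by (auto simp: A_def)
  qed
  moreover have "b < u x" if "Sup A < x" for x
    using that cSup_upper[OF _ bdd, of x] by (force simp: A_def)
  ultimately show thesis using that by blast
qed

section \<open>Limits at infinity, expressed by \<open>Inf\<close> and \<open>Sup\<close> of the
  range\<close>

lemma classM_bdd: "u \<in> classM \<Longrightarrow> bdd_above (range u)" "u \<in> classM \<Longrightarrow> bdd_below (range u)"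
  by (auto intro!: bdd_aboveI2[of _ _ 1] bdd_belowI2[of _ 0] simp: classM_le_1 classM_nonneg)

lemma classM_tendsto_top: "u \<in> classM \<Longrightarrow> (u \<longlongrightarrow> Sup (range u)) at_top"
proof (rule order_tendstoI)
  assume u: "u \<in> classM"
  fix a
  show "\<forall>\<^sub>F x in at_top. a < u x" if "a < Sup (range u)"
    using that less_cSup_iff[OF _ classM_bdd(1)[OF u]] classM_mono[OF u]
    by (auto simp: eventually_at_top_linorder) (meson less_le_trans)
  show "\<forall>\<^sub>F x in at_top. u x < a" if "Sup (range u) < a"
    using that cSUP_upper[OF _ classM_bdd(1)[OF u]] by (auto intro!: always_eventually intro: le_less_trans)
qed

lemma classM_tendsto_bot: "u \<in> classM \<Longrightarrow> (u \<longlongrightarrow> Inf (range u)) at_bot"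
proof (rule order_tendstoI)
  assume u: "u \<in> classM"
  fix a
  show "\<forall>\<^sub>F x in at_bot. u x < a" if "a > Inf (range u)"
    using that cInf_less_iff[OF _ classM_bdd(2)[OF u]] classM_mono[OF u]
    by (auto simp: eventually_at_bot_linorder) (meson le_less_trans)
  show "\<forall>\<^sub>F x in at_bot. a < u x" if "a < Inf (range u)"
    using that cINF_lower[OF classM_bdd(2)[OF u]] by (auto intro!: always_eventually intro: less_le_trans)
qed

lemma classM_le_Sup: "u \<in> classM \<Longrightarrow> u x \<le> Sup (range u)"
  by (intro cSup_upper classM_bdd) auto

lemma classM_Inf_le: "u \<in> classM \<Longrightarrow> Inf (range u) \<le> u x"
  by (intro cInf_lower classM_bdd) auto

section \<open>Weak convergence\<close>

text \<open>For monotone functions this is convergence at every continuity point of the limit.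
  Comparing at two points \<open>x < y\<close> avoids any mention of continuity points.\<close>

definition wconv :: "(nat \<Rightarrow> real \<Rightarrow> real) \<Rightarrow> (real \<Rightarrow> real) \<Rightarrow> bool" where
  "wconv us u \<longleftrightarrow> (\<forall>x y e. x < y \<longrightarrow> e > 0 \<longrightarrow> (\<forall>\<^sub>F k in sequentially. u x < us k y + e \<and> us k x < u y + e))"

lemma wconvD:
  assumes "wconv us u" "x < y" "e > 0"
  shows "\<forall>\<^sub>F k in sequentially. u x < us k y + e" "\<forall>\<^sub>F k in sequentially. us k x < u y + e"
  using assms by (auto simp: wconv_def eventually_conj_iff)

lemma wconv_const: "mono u \<Longrightarrow> wconv (\<lambda>_. u) u"
  unfolding wconv_def
proof (intro allI impI always_eventually)
  fix x y e :: real assume "mono u" "x < y" "e > 0"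
  then show "u x < u y + e \<and> u x < u y + e" using monoD[of u x y] by simp
qed

lemma wconv_shift:
  assumes us: "\<And>k. us k \<in> classM" "u \<in> classM" "wconv us u" and c: "c \<longlonglongrightarrow> c0"
  shows "wconv (\<lambda>k. shiftT (c k) (us k)) (shiftT c0 u)"
  unfolding wconv_def shiftT_def
proof (intro allI impI)
  fix x y e :: real assume "x < y" "e > 0"
  \<comment> \<open>The intermediate point \<open>x + d - c0\<close> leaves room \<open>d\<close> on
    one side and \<open>2 * d\<close> on the other for the error of \<open>c k\<close>.\<close>
  define d where "d = (y - x) / 3"
  have d: "d > 0" using \<open>x < y\<close> by (simp add: d_def)
  have "\<forall>\<^sub>F k in sequentially. dist (c k) c0 < d" using tendstoD[OF c d] .
  moreover have "\<forall>\<^sub>F k in sequentially. u (x - c0) < us k (x + d - c0) + e"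
    by (rule wconvD[OF us(3)]) (use d \<open>e > 0\<close> in auto)
  moreover have "\<forall>\<^sub>F k in sequentially. us k (x + d - c0) < u (y - c0) + e"
    by (rule wconvD[OF us(3)]) (use d \<open>e > 0\<close> in \<open>auto simp: d_def field_simps\<close>)
  ultimately show "\<forall>\<^sub>F k in sequentially. u (x - c0) < us k (y - c k) + e \<and> us k (x - c k) < u (y - c0) + e"
  proof eventually_elim
    case (elim k)
    have "us k (x + d - c0) \<le> us k (y - c k)" "us k (x - c k) \<le> us k (x + d - c0)"
      using abs_less_iff[of "c k - c0" d] elim(1) \<open>x < y\<close>
      by (intro classM_mono[OF us(1)]; simp add: dist_real_def d_def field_simps)+
    then show ?case using elim by auto
  qed
qed

text \<open>By left continuity only the values just to the left of \<open>x\<close> count, so an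
  inequality on some \<open>(a, x)\<close>, up to a vanishing error, passes to the limit at
  \<open>x\<close>. Thus inequalities valid on a half-line alone can be used.\<close>

lemma wconv_le:
  assumes u: "u \<in> classM" "wconv us u" and v: "wconv vs v" and "a < x"
    and le: "\<And>y e. a < y \<Longrightarrow> y < x \<Longrightarrow> e > 0 \<Longrightarrow> \<forall>\<^sub>F k in sequentially. us k y \<le> vs k y + e"
  shows "u x \<le> v x"
proof (rule field_le_epsilon)
  fix e :: real assume e: "e > 0"
  \<comment> \<open>Four losses of \<open>d\<close>: left continuity at \<open>x\<close>, the limit
    from \<open>y\<close> to \<open>z\<close>, the hypothesis at \<open>z\<close>, the limit from
    \<open>z\<close> to \<open>x\<close>.\<close>
  define d where "d = e / 4"
  have d: "d > 0" using e by (simp add: d_def)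
  obtain y0 where y0: "y0 < x" "u x - d < u y0" using classM_left[OF u(1) d] by blast
  define y where "y = max y0 ((a + x) / 2)"
  have y: "y < x" "a < y" "u x - d < u y"
    using y0 \<open>a < x\<close> classM_mono[OF u(1), of y0 y] by (auto simp: y_def less_max_iff_disj)
  define z where "z = (y + x) / 2"
  have z: "y < z" "z < x" using y by (auto simp: z_def)
  have az: "a < z" using y z by simp
  have "\<forall>\<^sub>F k in sequentially. u x \<le> v x + e"
    using wconvD(1)[OF u(2) z(1) d] wconvD(2)[OF v z(2) d] le[OF az z(2) d]
  proof eventually_elim
    case (elim k)
    then show ?case using y z by (auto simp: d_def)
  qed
  then show "u x \<le> v x + e" by simp
qed

lemma wconv_bounds:
  assumes u: "u \<in> classM" "wconv us u"
  shows "(\<And>y. y < x \<Longrightarrow> \<forall>\<^sub>F k in sequentially. us k y \<le> b) \<Longrightarrow> u x \<le> b"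
    and "a < x \<Longrightarrow> (\<And>y. a < y \<Longrightarrow> y < x \<Longrightarrow> \<forall>\<^sub>F k in sequentially. b \<le> us k y) \<Longrightarrow> b \<le> u x"
proof -
  assume *: "\<And>y. y < x \<Longrightarrow> \<forall>\<^sub>F k in sequentially. us k y \<le> b"
  show "u x \<le> b"
    by (rule wconv_le[OF u wconv_const[of "\<lambda>_. b"], of "x - 1"]) (auto simp: mono_def elim!: eventually_mono[OF *])
next
  assume "a < x" and *: "\<And>y. a < y \<Longrightarrow> y < x \<Longrightarrow> \<forall>\<^sub>F k in sequentially. b \<le> us k y"
  show "b \<le> u x"
  proof (rule field_le_epsilon)
    fix e :: real assume "e > 0"
    obtain y where y: "a < y" "y < x" using dense[OF \<open>a < x\<close>] by blast
    have "\<forall>\<^sub>F k in sequentially. b \<le> u x + e"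
      using wconvD(2)[OF u(2) y(2) \<open>e > 0\<close>] *[OF y] by eventually_elim auto
    then show "b \<le> u x + e" by simp
  qed
qed

text \<open>Far translates flatten out to the limit at infinity; this is how the hypotheses on
  constants come to bear on profiles.\<close>

lemma wconv_shift_top:
  assumes u: "u \<in> classM"
  shows "wconv (\<lambda>k. shiftT (- real k) u) (\<lambda>_. Sup (range u))"
  unfolding wconv_def shiftT_def
proof (intro allI impI)
  fix x y e :: real assume "e > 0"
  have "filterlim (\<lambda>k. y - (- real k)) at_top sequentially"
    using filterlim_tendsto_add_at_top[OF tendsto_const filterlim_real_sequentially, of y] by simp
  then have "((\<lambda>k. u (y - (- real k))) \<longlongrightarrow> Sup (range u)) sequentially"
    by (rule filterlim_compose[OF classM_tendsto_top[OF u]])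
  then have "\<forall>\<^sub>F k in sequentially. Sup (range u) - e < u (y - (- real k))"
    by (rule order_tendstoD) (use \<open>e > 0\<close> in auto)
  then show "\<forall>\<^sub>F k in sequentially. Sup (range u) < u (y - (- real k)) + e \<and> u (x - (- real k)) < Sup (range u) + e"
  proof eventually_elim
    case (elim k)
    then show ?case using classM_le_Sup[OF u, of "x - (- real k)"] \<open>e > 0\<close> by auto
  qed
qed

lemma wconv_shift_bot:
  assumes u: "u \<in> classM"
  shows "wconv (\<lambda>k. shiftT (real k) u) (\<lambda>_. Inf (range u))"
  unfolding wconv_def shiftT_def
proof (intro allI impI)
  fix x y e :: real assume "e > 0"
  have "filterlim (\<lambda>k. x - real k) at_bot sequentially"
    using filterlim_tendsto_add_at_top[OF tendsto_const filterlim_real_sequentially, of "-x"]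
    by (simp add: filterlim_uminus_at_bot)
  then have "((\<lambda>k. u (x - real k)) \<longlongrightarrow> Inf (range u)) sequentially"
    by (rule filterlim_compose[OF classM_tendsto_bot[OF u]])
  then have "\<forall>\<^sub>F k in sequentially. u (x - real k) < Inf (range u) + e"
    by (rule order_tendstoD) (use \<open>e > 0\<close> in auto)
  then show "\<forall>\<^sub>F k in sequentially. Inf (range u) < u (y - real k) + e \<and> u (x - real k) < Inf (range u) + e"
  proof eventually_elim
    case (elim k)
    then show ?case using classM_Inf_le[OF u, of "y - real k"] \<open>e > 0\<close> by auto
  qed
qed

lemma classM_compact:
  fixes us :: "nat \<Rightarrow> real \<Rightarrow> real"
  assumes us: "\<And>k. us k \<in> classM"
  obtains r u where "strict_mono r" "u \<in> classM" "wconv (us \<circ> r) u"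
proof -
  \<comment> \<open>Helly's theorem is about right continuous functions; reflecting both axes
    exchanges the two continuities and keeps monotonicity.\<close>
  define f where "f = (\<lambda>k x. - us k (- x))"
  have cont: "continuous (at_right x) (f k)" for k x
  proof -
    have "(us k \<longlongrightarrow> us k (- x)) (at_left (- x))"
      using us[of k] by (auto simp: classM_def continuous_within)
    then have "((\<lambda>y. us k (- y)) \<longlongrightarrow> us k (- x)) (at_right x)"
      by (simp add: filterlim_at_left_to_right)
    then show ?thesis unfolding continuous_within f_def by (intro tendsto_minus)
  qed
  have mono: "mono (f k)" for k using classM_mono[OF us] by (auto simp: f_def mono_def)
  have bdd: "\<bar>f k x\<bar> \<le> 1" for k x
    using classM_nonneg[OF us, of k "- x"] classM_le_1[OF us, of k "- x"] by (simp add: f_def)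
  obtain r F where r: "strict_mono r" and F: "\<And>x. continuous (at_right x) F" "mono F"
    and lim: "\<And>x. isCont F x \<Longrightarrow> (\<lambda>k. f (r k) x) \<longlonglongrightarrow> F x"
    using Helly_selection[of f 1, OF cont mono bdd] by metis
  define u where "u = (\<lambda>x. - F (- x))"
  have mu: "mono u" using F(2) by (auto simp: u_def mono_def)
  \<comment> \<open>A monotone function has only countably many discontinuities, so continuity
    points are dense, and one of them between \<open>x\<close> and \<open>y\<close> gives the
    comparison required by \<open>wconv\<close>.\<close>
  have cont_pt: "\<exists>z. x < z \<and> z < y \<and> isCont F z" if "x < y" for x y
  proof -
    have "uncountable {x<..<y}" using that uncountable_open_interval by auto
    moreover have "countable {z. \<not> isCont F z}" by (rule mono_ctble_discont[OF F(2)])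
    ultimately have "\<not> {x<..<y} \<subseteq> {z. \<not> isCont F z}" using countable_subset by blast
    then show ?thesis by auto
  qed
  have w: "wconv (us \<circ> r) u"
    unfolding wconv_def
  proof (intro allI impI)
    fix x y e :: real assume "x < y" "e > 0"
    obtain z where z: "- y < z" "z < - x" "isCont F z" using cont_pt[of "- y" "- x"] \<open>x < y\<close> by auto
    have "\<forall>\<^sub>F k in sequentially. dist (f (r k) z) (F z) < e" by (rule tendstoD[OF lim[OF z(3)] \<open>e > 0\<close>])
    then show "\<forall>\<^sub>F k in sequentially. u x < (us \<circ> r) k y + e \<and> (us \<circ> r) k x < u y + e"
    proof eventually_elim
      case (elim k)
      have "us (r k) (- z) \<le> us (r k) y" "us (r k) x \<le> us (r k) (- z)"
        using z by (auto intro!: classM_mono[OF us])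
      moreover have "F (- y) \<le> F z" "F z \<le> F (- x)" using z F(2) by (auto simp: mono_def)
      ultimately show ?case using elim by (auto simp: u_def f_def dist_real_def)
    qed
  qed
  have left: "continuous (at_left x) u" for x
  proof -
    have "(F \<longlongrightarrow> F (- x)) (at_right (- x))" using F(1) by (simp add: continuous_within)
    then have "((\<lambda>y. F (- y)) \<longlongrightarrow> F (- x)) (at_left x)"
      by (subst filterlim_at_left_to_right) simp
    then show ?thesis unfolding continuous_within u_def by (intro tendsto_minus)
  qed
  have "0 \<le> u x \<and> u x \<le> 1" for x
  proof (intro conjI; rule field_le_epsilon)
    fix e :: real assume e: "e > 0"
    have lt: "x - 1 < x" "x < x + 1" by simp_all
    have "\<forall>\<^sub>F k in sequentially. 0 \<le> u x + e"
      using wconvD(2)[OF w lt(1) e]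
    proof eventually_elim
      case (elim k)
      then show ?case using classM_nonneg[OF us, of "r k" "x - 1"] by simp
    qed
    then show "0 \<le> u x + e" by simp
    have "\<forall>\<^sub>F k in sequentially. u x \<le> 1 + e"
      using wconvD(1)[OF w lt(2) e]
    proof eventually_elim
      case (elim k)
      then show ?case using classM_le_1[OF us, of "r k" "x + 1"] by simp
    qed
    then show "u x \<le> 1 + e" by simp
  qed
  then have "u \<in> classM" using mu left by (auto simp: classM_def)
  then show thesis using that r w by blast
qed

text \<open>Monotonicity reduces uniformity on a bounded interval to finitely many grid points, at
  the price of a horizontal shift by \<open>e\<close>.\<close>

lemma wconv_uniform:
  fixes a b e :: real
  assumes us: "\<And>k. us k \<in> classM" and u: "u \<in> classM" and w: "wconv us u" and e: "e > 0"
  shows "\<forall>\<^sub>F k in sequentially. \<forall>x\<in>{a..b}. u x \<le> us k (x + e) + e \<and> us k (x - e) \<le> u x + e"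
proof -
  \<comment> \<open>Two mesh widths make up \<open>e\<close>: a point in the cell of
    \<open>g j\<close> is compared with \<open>g (j + 2)\<close> on the right and
    \<open>g (j - 1)\<close> on the left.\<close>
  define h where "h = e / 2"
  define g where "g j = a + real_of_int j * h" for j
  \<comment> \<open>One index more on either side, for the neighbours \<open>j - 1\<close> and
    \<open>j + 1\<close>.\<close>
  define J where "J = {-1..\<lfloor>(b - a) / h\<rfloor> + 1}"
  have h: "h > 0" using e by (simp add: h_def)
  have "\<forall>\<^sub>F k in sequentially. \<forall>j\<in>J. u (g j) < us k (g (j + 1)) + e \<and> us k (g j) < u (g (j + 1)) + e"
  proof (rule eventually_ball_finite)
    show "finite J" by (simp add: J_def)
    show "\<forall>j\<in>J. \<forall>\<^sub>F k in sequentially. u (g j) < us k (g (j + 1)) + e \<and> us k (g j) < u (g (j + 1)) + e"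
    proof
      fix j
      have "g j < g (j + 1)" using h by (simp add: g_def algebra_simps)
      then show "\<forall>\<^sub>F k in sequentially. u (g j) < us k (g (j + 1)) + e \<and> us k (g j) < u (g (j + 1)) + e"
        using wconvD[OF w _ e] by (intro eventually_conj)
    qed
  qed
  then show ?thesis
  proof eventually_elim
    case (elim k)
    show ?case
    proof
      fix x assume x: "x \<in> {a..b}"
      define j where "j = \<lfloor>(x - a) / h\<rfloor>"
      have j: "real_of_int j \<le> (x - a) / h" "(x - a) / h < real_of_int j + 1"
        unfolding j_def by linarith+
      have gx: "g j \<le> x" "x < g j + h"
        using j h by (simp_all add: g_def field_simps)
      have G: "g (j + 1) = g j + h" "g (j + 1 + 1) = g j + 2 * h" "g (j - 1) = g j - h" "g (j - 1 + 1) = g j"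
        by (simp_all add: g_def algebra_simps)
      have "0 \<le> j" using x h by (simp add: j_def)
      moreover have "j \<le> \<lfloor>(b - a) / h\<rfloor>"
        unfolding j_def using x h by (intro floor_mono divide_right_mono) auto
      ultimately have J: "j + 1 \<in> J" "j - 1 \<in> J" by (auto simp: J_def)
      have "u (g (j + 1)) < us k (g (j + 1 + 1)) + e" "us k (g (j - 1)) < u (g (j - 1 + 1)) + e"
        using elim J by blast+
      moreover have "u x \<le> u (g (j + 1))" "us k (g (j + 1 + 1)) \<le> us k (x + e)"
        "us k (x - e) \<le> us k (g (j - 1))" "u (g (j - 1 + 1)) \<le> u x"
        using gx h by (intro classM_mono[OF u] classM_mono[OF us]; simp only: G; simp add: h_def)+
      ultimately show "u x \<le> us k (x + e) + e \<and> us k (x - e) \<le> u x + e" by linarith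
    qed
  qed
qed

text \<open>A nonempty open interval is not a null set. So almost everywhere convergence supplies a
  point of convergence wherever monotonicity leaves room.\<close>

lemma AE_lborel_in_interval:
  fixes a b :: real
  assumes "AE x in lborel. P x" "a < b"
  obtains x where "a < x" "x < b" "P x"
proof -
  have "\<exists>x. a < x \<and> x < b \<and> P x"
  proof (rule ccontr)
    assume "\<not> ?thesis"
    then have "AE x in lborel. x \<notin> {a<..<b}"
      using assms(1) by (auto elim!: eventually_mono)
    then have "{a<..<b} \<in> null_sets lborel" by (subst AE_iff_null_sets) auto
    then show False using \<open>a < b\<close> by (auto simp: null_sets_def)
  qed
  then show thesis using that by blast
qed

lemma unif_conv_boundedI:
  assumes "\<And>a b e. e > 0 \<Longrightarrow> \<forall>\<^sub>F k in sequentially. \<forall>x\<in>{a..b}. \<bar>us k x - u x\<bar> < e"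
  shows "unif_conv_bounded us u"
  using assms unfolding unif_conv_bounded_def by blast

section \<open>Bistable maps\<close>

text \<open>These are hypotheses (i) to (iv). The one-sided waves are built from them alone; (v)
  enters in \<open>propagating_bistable_map\<close>.\<close>

locale bistable_map =
  fixes Q :: "(real \<Rightarrow> real) \<Rightarrow> real \<Rightarrow> real" and \<alpha> :: real
  assumes Q_in: "u \<in> classM \<Longrightarrow> Q u \<in> classM"
    and Q_AE: "(\<And>k. us k \<in> classM) \<Longrightarrow> u \<in> classM \<Longrightarrow> unif_conv_bounded us u \<Longrightarrow>
      AE x in lborel. (\<lambda>k. Q (us k) x) \<longlonglongrightarrow> Q u x"
    and Q_mono: "u \<in> classM \<Longrightarrow> v \<in> classM \<Longrightarrow> u \<le> v \<Longrightarrow> Q u \<le> Q v"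
    and Q_shift: "u \<in> classM \<Longrightarrow> Q (shiftT a u) = shiftT a (Q u)"
    and alpha: "0 < \<alpha>" "\<alpha> < 1"
    and Q_alpha: "Q (\<lambda>_. \<alpha>) = (\<lambda>_. \<alpha>)"
    and Q_below: "0 < g \<Longrightarrow> g < \<alpha> \<Longrightarrow> Q (\<lambda>_. g) x < g"
    and Q_above: "\<alpha> < g \<Longrightarrow> g < 1 \<Longrightarrow> g < Q (\<lambda>_. g) x"
begin

text \<open>Jumps of the limit prevent uniform convergence of the sequence itself, but its minimum
  (maximum) of the limit with the sequence translated by a fixed amount does converge uniformly on
  bounded intervals.\<close>

lemma wconv_Q:
  assumes us: "\<And>k. us k \<in> classM" and u: "u \<in> classM" and w: "wconv us u"
  shows "wconv (\<lambda>k. Q (us k)) (Q u)"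
  unfolding wconv_def
proof (intro allI impI eventually_conj)
  fix x y e :: real assume xy: "x < y" and e: "e > 0"
  define d where "d = (y - x) / 2"
  have d: "d > 0" using xy by (simp add: d_def)
  show "\<forall>\<^sub>F k in sequentially. Q u x < Q (us k) y + e"
  proof -
    define v where "v k = (\<lambda>z. min (u z) (shiftT (- d) (us k) z))" for k
    have v: "v k \<in> classM" for k unfolding v_def by (intro classM_min classM_shift us u)
    have "unif_conv_bounded v u"
    proof (rule unif_conv_boundedI)
      fix a b e :: real assume "e > 0"
      define h where "h = min e d / 2"
      have h: "h > 0" "h < e" "h < d" using \<open>e > 0\<close> d by (auto simp: h_def)
      show "\<forall>\<^sub>F k in sequentially. \<forall>z\<in>{a..b}. \<bar>v k z - u z\<bar> < e"
        using wconv_uniform[OF us u w h(1), of a b]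
      proof eventually_elim
        case (elim k)
        show ?case
        proof
          fix z assume "z \<in> {a..b}"
          then have "u z \<le> us k (z + h) + h" using elim by blast
          moreover have "us k (z + h) \<le> us k (z + d)" using h by (intro classM_mono[OF us]) auto
          ultimately show "\<bar>v k z - u z\<bar> < e" using h by (auto simp: v_def shiftT_def min_def)
        qed
      qed
    qed
    \<comment> \<open>With \<open>z\<close> in \<open>(x, x + d)\<close>, monotonicity gives
      \<open>Q u x \<le> Q u z\<close>, and the shift by \<open>d\<close> still ends at
      \<open>z + d < y\<close>.\<close>
    from Q_AE[OF v u this] obtain z where z: "x < z" "z < x + d" "(\<lambda>k. Q (v k) z) \<longlonglongrightarrow> Q u z"
      by (rule AE_lborel_in_interval[of _ x "x + d"]) (use d in auto)
    from tendstoD[OF z(3) e] show ?thesis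
    proof eventually_elim
      case (elim k)
      have "Q (v k) \<le> Q (shiftT (- d) (us k))"
        by (intro Q_mono v classM_shift us) (auto simp: v_def le_fun_def)
      then have "Q (v k) z \<le> Q (us k) (z + d)"
        unfolding Q_shift[OF us] by (simp add: le_fun_def shiftT_def)
      also have "\<dots> \<le> Q (us k) y" using z by (intro classM_mono[OF Q_in[OF us]]) (auto simp: d_def field_simps)
      finally show ?case
        using elim classM_mono[OF Q_in[OF u], of x z] z by (auto simp: dist_real_def)
    qed
  qed
  show "\<forall>\<^sub>F k in sequentially. Q (us k) x < Q u y + e"
  proof -
    define v where "v k = (\<lambda>z. max (u z) (shiftT d (us k) z))" for k
    have v: "v k \<in> classM" for k unfolding v_def by (intro classM_max classM_shift us u)
    have "unif_conv_bounded v u"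
    proof (rule unif_conv_boundedI)
      fix a b e :: real assume "e > 0"
      define h where "h = min e d / 2"
      have h: "h > 0" "h < e" "h < d" using \<open>e > 0\<close> d by (auto simp: h_def)
      show "\<forall>\<^sub>F k in sequentially. \<forall>z\<in>{a..b}. \<bar>v k z - u z\<bar> < e"
        using wconv_uniform[OF us u w h(1), of a b]
      proof eventually_elim
        case (elim k)
        show ?case
        proof
          fix z assume "z \<in> {a..b}"
          then have "us k (z - h) \<le> u z + h" using elim by blast
          moreover have "us k (z - d) \<le> us k (z - h)" using h by (intro classM_mono[OF us]) auto
          ultimately show "\<bar>v k z - u z\<bar> < e" using h by (auto simp: v_def shiftT_def max_def)
        qed
      qed
    qed
    from Q_AE[OF v u this] obtain z where z: "x + d < z" "z < y" "(\<lambda>k. Q (v k) z) \<longlonglongrightarrow> Q u z"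
      by (rule AE_lborel_in_interval[of _ "x + d" y]) (use xy in \<open>auto simp: d_def field_simps\<close>)
    from tendstoD[OF z(3) e] show ?thesis
    proof eventually_elim
      case (elim k)
      have "Q (shiftT d (us k)) \<le> Q (v k)"
        by (intro Q_mono v classM_shift us) (auto simp: v_def le_fun_def)
      then have *: "Q (us k) (z - d) \<le> Q (v k) z"
        unfolding Q_shift[OF us] by (simp add: le_fun_def shiftT_def)
      have "Q (us k) x \<le> Q (us k) (z - d)" using z by (intro classM_mono[OF Q_in[OF us]]) auto
      also note *
      finally show ?case
        using elim classM_mono[OF Q_in[OF u], of z y] z by (auto simp: dist_real_def)
    qed
  qed
qed

definition Qc :: "real \<Rightarrow> (real \<Rightarrow> real) \<Rightarrow> real \<Rightarrow> real" where
  "Qc c u = shiftT c (Q u)"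

lemma Qc_in: "u \<in> classM \<Longrightarrow> Qc c u \<in> classM"
  by (simp add: Qc_def Q_in classM_shift)

lemma Qc_mono: "u \<in> classM \<Longrightarrow> v \<in> classM \<Longrightarrow> u \<le> v \<Longrightarrow> Qc c u \<le> Qc c v"
  using Q_mono[of u v] by (simp add: Qc_def le_fun_def shiftT_def)

lemma Qc_shift: "u \<in> classM \<Longrightarrow> Qc c (shiftT a u) = shiftT a (Qc c u)"
  by (simp add: Qc_def Q_shift) (simp add: shiftT_def algebra_simps)

lemma Qc_alpha: "Qc c (\<lambda>_. \<alpha>) = (\<lambda>_. \<alpha>)"
  by (simp add: Qc_def Q_alpha shiftT_def)

lemma wconv_Qc:
  assumes "\<And>k. us k \<in> classM" "u \<in> classM" "wconv us u" "c \<longlonglongrightarrow> c0"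
  shows "wconv (\<lambda>k. Qc (c k) (us k)) (Qc c0 u)"
  unfolding Qc_def using assms by (intro wconv_shift wconv_Q Q_in)

section \<open>Limits at infinity of subsolutions and supersolutions\<close>

lemma constant_limit:
  assumes u: "u \<in> classM" and w: "wconv (\<lambda>k. shiftT (d k) u) (\<lambda>_. g)" and g: "0 \<le> g" "g \<le> 1"
  shows "(\<And>y. \<forall>\<^sub>F k in sequentially. u (y - d k) \<le> Qc c u (y - d k)) \<Longrightarrow> g \<le> Qc c (\<lambda>_. g) 0"
    and "(\<And>y. \<forall>\<^sub>F k in sequentially. Qc c u (y - d k) \<le> u (y - d k)) \<Longrightarrow> Qc c (\<lambda>_. g) 0 \<le> g"
proof -
  \<comment> \<open>Since \<open>Qc c\<close> commutes with translation, these functions are the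
    same translates of \<open>Qc c u\<close>; an inequality valid far out therefore passes to the
    constant \<open>g\<close>.\<close>
  have wQ: "wconv (\<lambda>k. Qc c (shiftT (d k) u)) (Qc c (\<lambda>_. g))"
    by (rule wconv_Qc) (use u w g in \<open>auto intro: classM_shift classM_const\<close>)
  have eq: "Qc c (shiftT (d k) u) y = Qc c u (y - d k)" "shiftT (d k) u y = u (y - d k)" for k y
    unfolding Qc_shift[OF u] by (simp_all add: shiftT_def)
  have neg: "(-1::real) < 0" by simp
  {
    assume *: "\<And>y. \<forall>\<^sub>F k in sequentially. u (y - d k) \<le> Qc c u (y - d k)"
    show "g \<le> Qc c (\<lambda>_. g) 0"
    proof (rule wconv_le[OF classM_const[OF g] w wQ neg])
      fix y e :: real assume "e > 0"
      with * [of y] show "\<forall>\<^sub>F k in sequentially. shiftT (d k) u y \<le> Qc c (shiftT (d k) u) y + e"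
        by (auto elim!: eventually_mono simp: eq)
    qed
  next
    assume *: "\<And>y. \<forall>\<^sub>F k in sequentially. Qc c u (y - d k) \<le> u (y - d k)"
    show "Qc c (\<lambda>_. g) 0 \<le> g"
    proof (rule wconv_le[OF Qc_in[OF classM_const[OF g]] wQ w neg])
      fix y e :: real assume "e > 0"
      with * [of y] show "\<forall>\<^sub>F k in sequentially. Qc c (shiftT (d k) u) y \<le> shiftT (d k) u y + e"
        by (auto elim!: eventually_mono simp: eq)
    qed
  }
qed

text \<open>\<open>Q\<close> lowers constants in \<open>(0, \<alpha>)\<close> and raises those in
  \<open>(\<alpha>, 1)\<close>, so the limit of a subsolution avoids the first interval and that of
  a supersolution the second. An inequality beyond some \<open>C\<close> suffices, as is all that
  some truncated limits provide.\<close>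

lemma Sup_dichotomy:
  assumes u: "u \<in> classM"
  shows "(\<And>x. C < x \<Longrightarrow> u x \<le> Qc c u x) \<Longrightarrow> Sup (range u) \<le> 0 \<or> \<alpha> \<le> Sup (range u)"
    and "(\<And>x. C < x \<Longrightarrow> Qc c u x \<le> u x) \<Longrightarrow> Sup (range u) \<le> \<alpha> \<or> 1 \<le> Sup (range u)"
proof -
  have S: "0 \<le> Sup (range u)" "Sup (range u) \<le> 1"
    using classM_nonneg[OF u, of 0] classM_le_Sup[OF u, of 0]
    by (auto intro!: cSUP_least classM_le_1[OF u])
  have ev: "\<forall>\<^sub>F k in sequentially. C < y - - real k" for y
    using eventually_gt_at_top[of "nat \<lceil>C - y\<rceil>"] by eventually_elim linarith
  {
    assume "\<And>x. C < x \<Longrightarrow> u x \<le> Qc c u x"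
    then have "Sup (range u) \<le> Qc c (\<lambda>_. Sup (range u)) 0"
      by (intro constant_limit(1)[OF u wconv_shift_top[OF u] S] eventually_mono[OF ev]) auto
    then show "Sup (range u) \<le> 0 \<or> \<alpha> \<le> Sup (range u)"
      using Q_below[of "Sup (range u)" "- c"] unfolding Qc_def shiftT_def by force
  next
    assume "\<And>x. C < x \<Longrightarrow> Qc c u x \<le> u x"
    then have "Qc c (\<lambda>_. Sup (range u)) 0 \<le> Sup (range u)"
      by (intro constant_limit(2)[OF u wconv_shift_top[OF u] S] eventually_mono[OF ev]) auto
    then show "Sup (range u) \<le> \<alpha> \<or> 1 \<le> Sup (range u)"
      using Q_above[of "Sup (range u)" "- c"] unfolding Qc_def shiftT_def by force
  }
qed

lemma Inf_dichotomy:
  assumes u: "u \<in> classM"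
  shows "(\<And>x. x < C \<Longrightarrow> u x \<le> Qc c u x) \<Longrightarrow> Inf (range u) \<le> 0 \<or> \<alpha> \<le> Inf (range u)"
    and "(\<And>x. x < C \<Longrightarrow> Qc c u x \<le> u x) \<Longrightarrow> Inf (range u) \<le> \<alpha> \<or> 1 \<le> Inf (range u)"
proof -
  have S: "0 \<le> Inf (range u)" "Inf (range u) \<le> 1"
    using classM_le_1[OF u, of 0] classM_Inf_le[OF u, of 0]
    by (auto intro!: cINF_greatest classM_nonneg[OF u])
  have ev: "\<forall>\<^sub>F k in sequentially. y - real k < C" for y
    using eventually_gt_at_top[of "nat \<lceil>y - C\<rceil>"] by eventually_elim linarith
  {
    assume "\<And>x. x < C \<Longrightarrow> u x \<le> Qc c u x"
    then have "Inf (range u) \<le> Qc c (\<lambda>_. Inf (range u)) 0"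
      by (intro constant_limit(1)[OF u wconv_shift_bot[OF u] S] eventually_mono[OF ev]) auto
    then show "Inf (range u) \<le> 0 \<or> \<alpha> \<le> Inf (range u)"
      using Q_below[of "Inf (range u)" "- c"] unfolding Qc_def shiftT_def by force
  next
    assume "\<And>x. x < C \<Longrightarrow> Qc c u x \<le> u x"
    then have "Qc c (\<lambda>_. Inf (range u)) 0 \<le> Inf (range u)"
      by (intro constant_limit(2)[OF u wconv_shift_bot[OF u] S] eventually_mono[OF ev]) auto
    then show "Inf (range u) \<le> \<alpha> \<or> 1 \<le> Inf (range u)"
      using Q_above[of "Inf (range u)" "- c"] unfolding Qc_def shiftT_def by force
  }
qed

end

section \<open>Waves between \<open>0\<close> and \<open>\<alpha>\<close>, and between
  \<open>\<alpha>\<close> and \<open>1\<close>\<close>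

lemma vanishing_sequence:
  assumes "s > 0"
  obtains e :: "nat \<Rightarrow> real" where "\<And>k. 0 < e k" "\<And>k. e k < s" "e \<longlonglongrightarrow> 0"
proof
  have "inverse (real (Suc k)) \<le> 1" for k by (simp add: field_simps)
  then have "s / 2 * inverse (real (Suc k)) \<le> s / 2 * 1" for k
    using assms by (intro mult_left_mono) auto
  then show "s / 2 * inverse (real (Suc k)) < s" for k using assms by (smt (verit) field_sum_of_halves mult.right_neutral)
  show "0 < s / 2 * inverse (real (Suc k))" for k using assms by simp
  show "(\<lambda>k. s / 2 * inverse (real (Suc k))) \<longlonglongrightarrow> 0"
    by (rule tendsto_mult_right_zero[OF LIMSEQ_inverse_real_of_nat])
qed

context bistable_map begin

lemma limit_profile:
  assumes us: "\<And>k. us k \<in> classM" and c: "c \<longlonglongrightarrow> c0"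
  obtains r u where "strict_mono r" "u \<in> classM" "wconv (\<lambda>k. us (r k)) u"
    "wconv (\<lambda>k. Qc (c (r k)) (us (r k))) (Qc c0 u)"
proof -
  obtain r u where r: "strict_mono r" and u: "u \<in> classM" and w: "wconv (us \<circ> r) u"
    using classM_compact[of us, OF us] by blast
  have "(\<lambda>k. c (r k)) \<longlonglongrightarrow> c0" using LIMSEQ_subseq_LIMSEQ[OF c r] by (simp add: comp_def)
  then have "wconv (\<lambda>k. Qc (c (r k)) (us (r k))) (Qc c0 u)"
    using w by (intro wconv_Qc us u) (simp_all add: comp_def)
  then show thesis using that r u w by (simp add: comp_def)
qed

text \<open>The errors vanish in a weak limit, which is an exact wave. The normalisation at the
  origin survives as \<open>u 0 \<le> b \<le> u 1\<close>, enough for the dichotomies to fix the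
  limits at infinity.\<close>

lemma wave_of_approximate_waves:
  assumes us: "\<And>k. us k \<in> classM" and level: "\<And>k. us k 0 \<le> b" "\<And>k x. 0 < x \<Longrightarrow> b < us k x"
    and e: "e \<longlonglongrightarrow> 0" and approx: "\<And>k x. \<bar>us k x - Qc c (us k) x\<bar> \<le> e k"
    and bounds: "\<And>k x. lo \<le> us k x" "\<And>k x. us k x \<le> hi"
  obtains u where "u \<in> classM" "Qc c u = u" "u 0 \<le> b" "b \<le> u 1" "\<And>x. lo \<le> u x" "\<And>x. u x \<le> hi"
proof -
  obtain r u where r: "strict_mono r" and u: "u \<in> classM" and w: "wconv (\<lambda>k. us (r k)) u"
    and wQ: "wconv (\<lambda>k. Qc c (us (r k))) (Qc c u)"
    using limit_profile[of us "\<lambda>_. c" c] us by auto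
  have er: "\<forall>\<^sub>F k in sequentially. e (r k) < d" if "d > 0" for d
    using order_tendstoD(2)[OF LIMSEQ_subseq_LIMSEQ[OF e r] that] by simp
  have lt: "x - 1 < x" for x :: real by simp
  have "Qc c u x = u x" for x
  proof (rule antisym)
    show "u x \<le> Qc c u x"
    proof (rule wconv_le[OF u w wQ lt])
      fix y d :: real assume "d > 0"
      from er[OF this] show "\<forall>\<^sub>F k in sequentially. us (r k) y \<le> Qc c (us (r k)) y + d"
      proof eventually_elim
        case (elim k)
        then show ?case using approx[of "r k" y] by linarith
      qed
    qed
    show "Qc c u x \<le> u x"
    proof (rule wconv_le[OF Qc_in[OF u] wQ w lt])
      fix y d :: real assume "d > 0"
      from er[OF this] show "\<forall>\<^sub>F k in sequentially. Qc c (us (r k)) y \<le> us (r k) y + d"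
      proof eventually_elim
        case (elim k)
        then show ?case using approx[of "r k" y] by linarith
      qed
    qed
  qed
  moreover have "u 0 \<le> b"
    using classM_mono[OF us, of _ 0] level(1)
    by (intro wconv_bounds(1)[OF u w] always_eventually) (meson less_imp_le order_trans)
  moreover have "b \<le> u 1"
    using level(2) by (intro wconv_bounds(2)[OF u w, of 0]) (auto intro!: always_eventually less_imp_le)
  moreover have "lo \<le> u x" for x
    by (rule wconv_bounds(2)[OF u w lt]) (simp add: bounds)
  moreover have "u x \<le> hi" for x
    by (rule wconv_bounds(1)[OF u w]) (simp add: bounds)
  ultimately show thesis using that[OF u] by blast
qed

text \<open>The obstacle \<open>f\<close> keeps the fixed point below the supersolution from collapsing to \<open>\<alpha>\<close>; it is
  lowered to \<open>\<alpha>\<close> while the profile is kept at a fixed level at the origin.\<close>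

lemma upper_wave_of_supersolution:
  assumes \<psi>: "\<psi> \<in> classM" "\<And>x. Qc c \<psi> x \<le> \<psi> x" and Inf: "Inf (range \<psi>) = \<alpha>" and Sup: "\<alpha> < Sup (range \<psi>)"
  obtains \<phi> where "\<phi> \<in> classM" "Qc c \<phi> = \<phi>" "Inf (range \<phi>) = \<alpha>" "Sup (range \<phi>) = 1"
proof -
  define b where "b = (1 + \<alpha>) / 2"
  \<comment> \<open>With \<open>e k < s\<close> the obstacle stays below the level \<open>b\<close>
    and below the limit of \<open>\<psi>\<close>, so some translate of \<open>\<psi>\<close> lies
    above it.\<close>
  define s where "s = min b (Sup (range \<psi>)) - \<alpha>"
  have b: "\<alpha> < b" "b < 1" using alpha by (auto simp: b_def)
  have s: "s > 0" using b Sup by (auto simp: s_def)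
  obtain e where e: "\<And>k. 0 < e k" "\<And>k. e k < s" and e0: "e \<longlonglongrightarrow> 0"
    using vanishing_sequence[OF s] by metis
  have "\<exists>v\<in>classM. v 0 \<le> b \<and> (\<forall>x>0. b < v x) \<and> (\<forall>x. \<bar>v x - Qc c v x\<bar> \<le> e k) \<and> (\<forall>x. \<alpha> \<le> v x)" for k
  proof -
    define f where "f = (\<lambda>x::real. if x \<le> 0 then \<alpha> else \<alpha> + e k)"
    have ek: "\<alpha> + e k < Sup (range \<psi>)" "\<alpha> + e k < b" using e(1)[of k] e(2)[of k] by (auto simp: s_def)
    have f: "f \<in> classM" unfolding f_def using ek e(1)[of k] e(2)[of k] b alpha by (intro classM_step) auto
    obtain y where y: "\<alpha> + e k < \<psi> y" using ek less_cSup_iff[OF _ classM_bdd(1)[OF \<psi>(1)]] by auto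
    define q where "q = shiftT (- y) \<psi>"
    have q: "q \<in> classM" unfolding q_def by (rule classM_shift[OF \<psi>(1)])
    have ge: "\<alpha> \<le> \<psi> x" for x using classM_Inf_le[OF \<psi>(1)] Inf by metis
    have fq: "f \<le> q"
    proof (rule le_funI)
      fix x show "f x \<le> q x"
        using ge[of "x + y"] classM_mono[OF \<psi>(1), of y "x + y"] y by (auto simp: f_def q_def shiftT_def)
    qed
    have Qq: "Qc c q x \<le> q x" for x using \<psi> by (simp add: q_def Qc_shift) (simp add: shiftT_def)
    obtain a where a: "a \<in> classM" "f \<le> a" "a \<le> q" and fp: "(\<lambda>x. max (Qc c a x) (f x)) = a"
    proof (rule classM_fixed_point[where G = "\<lambda>u x. max (Qc c u x) (f x)", OF _ _ f _ q _ fq])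
      show "(\<lambda>x. max (Qc c u x) (f x)) \<in> classM" if "u \<in> classM" for u
        by (intro classM_max Qc_in that f)
      show "(\<lambda>x. max (Qc c u x) (f x)) \<le> (\<lambda>x. max (Qc c v x) (f x))"
        if "u \<in> classM" "v \<in> classM" "u \<le> v" for u v
        using Qc_mono[OF that, of c] by (auto simp: le_fun_def intro: max.coboundedI1)
      show "(\<lambda>x. max (Qc c q x) (f x)) \<le> q" using Qq fq by (auto simp: le_fun_def)
    qed (auto simp: le_fun_def)
    have a_eq: "a x = max (Qc c a x) (f x)" for x using fun_cong[OF fp, of x] by simp
    have super: "Qc c a x \<le> a x" for x using a_eq[of x] by simp
    have a_ge: "\<alpha> \<le> a x" for x using le_funD[OF a(2), of x] e(1)[of k] e(2)[of k] by (auto simp: f_def split: if_splits)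
    have "(\<lambda>_. \<alpha>) \<le> Qc c a"
      using Qc_mono[OF _ a(1), of "\<lambda>_. \<alpha>" c] a_ge alpha by (auto simp: Qc_alpha classM_const le_fun_def)
    \<comment> \<open>Where the obstacle is active, \<open>a\<close> is at most
      \<open>\<alpha> + e k\<close>, while \<open>Qc c a\<close> is at least
      \<open>\<alpha>\<close>.\<close>
    then have sub: "a x \<le> Qc c a x + e k" for x
      using a_eq[of x] e(1)[of k] e(2)[of k] by (auto simp: le_fun_def f_def max_def split: if_splits) (smt (verit))+
    \<comment> \<open>\<open>a\<close> starts below level \<open>b\<close> because it lies below a
      translate of \<open>\<psi>\<close>, whose limit on the left is
      \<open>\<alpha>\<close>.\<close>
    obtain l where "\<psi> l < b"
      using b cInf_less_iff[OF _ classM_bdd(2)[OF \<psi>(1)]] Inf by auto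
    then have l: "a (l - y) \<le> b" using le_funD[OF a(3), of "l - y"] by (simp add: q_def shiftT_def)
    \<comment> \<open>The obstacle keeps the limit of the supersolution \<open>a\<close> above
      \<open>\<alpha>\<close>; the dichotomy then makes it \<open>1\<close>, and level
      \<open>b\<close> is crossed.\<close>
    have "\<alpha> < a 1" using le_funD[OF a(2), of 1] e(1)[of k] e(2)[of k] by (simp add: f_def)
    then have "1 \<le> Sup (range a)"
      using Sup_dichotomy(2)[OF a(1) super] classM_le_Sup[OF a(1), of 1] by linarith
    then obtain h where h: "b < a h" using b less_cSup_iff[OF _ classM_bdd(1)[OF a(1)], of b] by auto
    obtain z where z: "a z \<le> b" "\<And>x. z < x \<Longrightarrow> b < a x" using classM_level[OF a(1) l h] by blast
    show ?thesis
    proof (intro bexI[of _ "shiftT (- z) a"] conjI allI impI)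
      show "shiftT (- z) a \<in> classM" by (rule classM_shift[OF a(1)])
      show "\<bar>shiftT (- z) a x - Qc c (shiftT (- z) a) x\<bar> \<le> e k" for x
        using super[of "x + z"] sub[of "x + z"] by (simp add: Qc_shift[OF a(1)]) (simp add: shiftT_def)
    qed (use z a_ge in \<open>auto simp: shiftT_def\<close>)
  qed
  then obtain v where v: "\<And>k. v k \<in> classM" "\<And>k. v k 0 \<le> b" "\<And>k x. 0 < x \<Longrightarrow> b < v k x"
    "\<And>k x. \<bar>v k x - Qc c (v k) x\<bar> \<le> e k" "\<And>k x. \<alpha> \<le> v k x"
    by metis
  obtain u where u: "u \<in> classM" "Qc c u = u" "u 0 \<le> b" "b \<le> u 1" "\<And>x. \<alpha> \<le> u x"
    using wave_of_approximate_waves[OF v(1-3) e0 v(4,5) classM_le_1[OF v(1)]] by metis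
  have "Inf (range u) = \<alpha>"
  proof (rule antisym)
    show "\<alpha> \<le> Inf (range u)" using u(5) by (auto intro: cINF_greatest)
    show "Inf (range u) \<le> \<alpha>"
      using Inf_dichotomy(2)[OF u(1), of 0 c] classM_Inf_le[OF u(1), of 0] u(2,3) b by auto
  qed
  moreover have "Sup (range u) = 1"
  proof (rule antisym)
    show "Sup (range u) \<le> 1" by (auto intro: cSUP_least classM_le_1[OF u(1)])
    show "1 \<le> Sup (range u)"
      using Sup_dichotomy(2)[OF u(1), of 0 c] classM_le_Sup[OF u(1), of 1] u(2,4) b by auto
  qed
  ultimately show thesis using that u by blast
qed

text \<open>The mirror image, with an obstacle from above: \<open>f\<close> equals
  \<open>\<alpha> - e k\<close> on the left, which pushes the profile off \<open>\<alpha>\<close>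
  there, so that its limit on the left drops to \<open>0\<close>.\<close>

lemma lower_wave_of_subsolution:
  assumes \<psi>: "\<psi> \<in> classM" "\<And>x. \<psi> x \<le> Qc c \<psi> x" and Sup: "Sup (range \<psi>) = \<alpha>" and Inf: "Inf (range \<psi>) < \<alpha>"
  obtains \<phi> where "\<phi> \<in> classM" "Qc c \<phi> = \<phi>" "Inf (range \<phi>) = 0" "Sup (range \<phi>) = \<alpha>"
proof -
  define b where "b = \<alpha> / 2"
  define s where "s = \<alpha> - max b (Inf (range \<psi>))"
  have b: "0 < b" "b < \<alpha>" using alpha by (auto simp: b_def)
  have s: "s > 0" using b Inf by (auto simp: s_def)
  obtain e where e: "\<And>k. 0 < e k" "\<And>k. e k < s" and e0: "e \<longlonglongrightarrow> 0"
    using vanishing_sequence[OF s] by metis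
  have "\<exists>v\<in>classM. v 0 \<le> b \<and> (\<forall>x>0. b < v x) \<and> (\<forall>x. \<bar>v x - Qc c v x\<bar> \<le> e k) \<and> (\<forall>x. v x \<le> \<alpha>)" for k
  proof -
    define f where "f = (\<lambda>x::real. if x \<le> 0 then \<alpha> - e k else \<alpha>)"
    have ek: "Inf (range \<psi>) < \<alpha> - e k" "b < \<alpha> - e k" using e(1)[of k] e(2)[of k] by (auto simp: s_def)
    have f: "f \<in> classM" unfolding f_def using ek e(1)[of k] e(2)[of k] b alpha by (intro classM_step) auto
    obtain y where y: "\<psi> y < \<alpha> - e k" using ek cInf_less_iff[OF _ classM_bdd(2)[OF \<psi>(1)]] by auto
    define p where "p = shiftT (- y) \<psi>"
    have p: "p \<in> classM" unfolding p_def by (rule classM_shift[OF \<psi>(1)])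
    have le: "\<psi> x \<le> \<alpha>" for x using classM_le_Sup[OF \<psi>(1)] Sup by metis
    have pf: "p \<le> f"
    proof (rule le_funI)
      fix x show "p x \<le> f x"
        using le[of "x + y"] classM_mono[OF \<psi>(1), of "x + y" y] y by (auto simp: f_def p_def shiftT_def)
    qed
    have Qp: "p x \<le> Qc c p x" for x using \<psi> by (simp add: p_def Qc_shift) (simp add: shiftT_def)
    obtain a where a: "a \<in> classM" "p \<le> a" "a \<le> f" and fp: "(\<lambda>x. min (Qc c a x) (f x)) = a"
    proof (rule classM_fixed_point[where G = "\<lambda>u x. min (Qc c u x) (f x)", OF _ _ p _ f _ pf])
      show "(\<lambda>x. min (Qc c u x) (f x)) \<in> classM" if "u \<in> classM" for u
        by (intro classM_min Qc_in that f)
      show "(\<lambda>x. min (Qc c u x) (f x)) \<le> (\<lambda>x. min (Qc c v x) (f x))"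
        if "u \<in> classM" "v \<in> classM" "u \<le> v" for u v
        using Qc_mono[OF that, of c] by (auto simp: le_fun_def intro: min.coboundedI1)
      show "p \<le> (\<lambda>x. min (Qc c p x) (f x))" using Qp pf by (auto simp: le_fun_def)
    qed (auto simp: le_fun_def)
    have a_eq: "a x = min (Qc c a x) (f x)" for x using fun_cong[OF fp, of x] by simp
    have sub: "a x \<le> Qc c a x" for x using a_eq[of x] by simp
    have a_le: "a x \<le> \<alpha>" for x using le_funD[OF a(3), of x] e(1)[of k] e(2)[of k] by (auto simp: f_def split: if_splits)
    have "Qc c a \<le> (\<lambda>_. \<alpha>)"
      using Qc_mono[OF a(1), of "\<lambda>_. \<alpha>" c] a_le alpha by (auto simp: Qc_alpha classM_const le_fun_def)
    \<comment> \<open>Where the minimum is \<open>f\<close>, it is at least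
      \<open>\<alpha> - e k\<close>, while \<open>Qc c a\<close> is at most
      \<open>\<alpha>\<close>.\<close>
    then have super: "Qc c a x \<le> a x + e k" for x
      using a_eq[of x] e(1)[of k] e(2)[of k] by (auto simp: le_fun_def f_def min_def split: if_splits)
    obtain h where "b < \<psi> h"
      using b less_cSup_iff[OF _ classM_bdd(1)[OF \<psi>(1)]] Sup by auto
    then have h: "b < a (h - y)" using le_funD[OF a(2), of "h - y"] by (simp add: p_def shiftT_def)
    have "a 0 < \<alpha>" using le_funD[OF a(3), of 0] e(1)[of k] e(2)[of k] by (simp add: f_def)
    then have "Inf (range a) \<le> 0"
      using Inf_dichotomy(1)[OF a(1) sub] classM_Inf_le[OF a(1), of 0] by linarith
    then obtain l where "a l < b" using b cInf_less_iff[OF _ classM_bdd(2)[OF a(1)], of b] by auto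
    then have l: "a l \<le> b" by simp
    obtain z where z: "a z \<le> b" "\<And>x. z < x \<Longrightarrow> b < a x" using classM_level[OF a(1) l h] by blast
    show ?thesis
    proof (intro bexI[of _ "shiftT (- z) a"] conjI allI impI)
      show "shiftT (- z) a \<in> classM" by (rule classM_shift[OF a(1)])
      show "\<bar>shiftT (- z) a x - Qc c (shiftT (- z) a) x\<bar> \<le> e k" for x
        using sub[of "x + z"] super[of "x + z"] by (simp add: Qc_shift[OF a(1)]) (simp add: shiftT_def)
    qed (use z a_le in \<open>auto simp: shiftT_def\<close>)
  qed
  then obtain v where v: "\<And>k. v k \<in> classM" "\<And>k. v k 0 \<le> b" "\<And>k x. 0 < x \<Longrightarrow> b < v k x"
    "\<And>k x. \<bar>v k x - Qc c (v k) x\<bar> \<le> e k" "\<And>k x. v k x \<le> \<alpha>"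
    by metis
  obtain u where u: "u \<in> classM" "Qc c u = u" "u 0 \<le> b" "b \<le> u 1" "\<And>x. u x \<le> \<alpha>"
    using wave_of_approximate_waves[OF v(1-3) e0 v(4) classM_nonneg[OF v(1)] v(5)] by metis
  have "Sup (range u) = \<alpha>"
  proof (rule antisym)
    show "Sup (range u) \<le> \<alpha>" using u(5) by (auto intro: cSUP_least)
    show "\<alpha> \<le> Sup (range u)"
      using Sup_dichotomy(1)[OF u(1), of 0 c] classM_le_Sup[OF u(1), of 1] u(2,4) b by auto
  qed
  moreover have "Inf (range u) = 0"
  proof (rule antisym)
    show "0 \<le> Inf (range u)" by (auto intro: cINF_greatest classM_nonneg[OF u(1)])
    show "Inf (range u) \<le> 0"
      using Inf_dichotomy(1)[OF u(1), of 0 c] classM_Inf_le[OF u(1), of 0] u(2,3) b by auto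
  qed
  ultimately show thesis using that u by blast
qed

end

text \<open>A monotone subsequence is either bounded above or increasing without bound. Applied to
  distances, it decides whether a crossing or an end of the truncation interval is lost in the
  limit.\<close>

lemma real_subseq_cases:
  fixes a :: "nat \<Rightarrow> real"
  obtains r where "strict_mono r" "filterlim (\<lambda>k. a (r k)) at_top sequentially"
  | r :: "nat \<Rightarrow> nat" and C where "strict_mono r" "\<And>k. a (r k) \<le> C"
proof -
  obtain r where r: "strict_mono r" "monoseq (\<lambda>k. a (r k))" using seq_monosub[of a] by blast
  show thesis
  proof (cases "\<exists>C. \<forall>k. a (r k) \<le> C")
    case True
    then obtain C where "\<And>k. a (r k) \<le> C" by blast
    then show thesis by (rule that(2)[OF r(1)])
  next
    case False
    have "incseq (\<lambda>k. a (r k))"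
    proof (rule ccontr)
      assume "\<not> incseq (\<lambda>k. a (r k))"
      then have "decseq (\<lambda>k. a (r k))" using r(2) by (auto simp: monoseq_iff)
      then show False using False by (auto dest: decseqD[of _ 0])
    qed
    have "filterlim (\<lambda>k. a (r k)) at_top sequentially"
      unfolding filterlim_at_top
    proof
      fix Z
      obtain n where "Z < a (r n)" using False by (auto simp: not_le)
      then have "Z \<le> a (r k)" if "n \<le> k" for k
        using incseqD[OF \<open>incseq (\<lambda>k. a (r k))\<close> that] by simp
      then show "\<forall>\<^sub>F k in sequentially. Z \<le> a (r k)" by (auto simp: eventually_sequentially)
    qed
    then show thesis by (rule that(1)[OF r(1)])
  qed
qed

lemma filterlim_subseq_at_top:
  "filterlim a at_top sequentially \<Longrightarrow> strict_mono r \<Longrightarrow> filterlim (\<lambda>k. a (r k)) at_top sequentially"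
  by (rule filterlim_compose[OF _ filterlim_subseq])

section \<open>Truncated problems\<close>

text \<open>The added assumption is hypothesis (v), with the limits of the monotone profiles written
  as \<open>Inf\<close> and \<open>Sup\<close>.\<close>

locale propagating_bistable_map = bistable_map +
  assumes speeds: "\<phi>\<^sub>1 \<in> classM \<Longrightarrow> Qc c\<^sub>1 \<phi>\<^sub>1 = \<phi>\<^sub>1 \<Longrightarrow> Inf (range \<phi>\<^sub>1) = 0 \<Longrightarrow> Sup (range \<phi>\<^sub>1) = \<alpha> \<Longrightarrow>
      \<phi>\<^sub>2 \<in> classM \<Longrightarrow> Qc c\<^sub>2 \<phi>\<^sub>2 = \<phi>\<^sub>2 \<Longrightarrow> Inf (range \<phi>\<^sub>2) = \<alpha> \<Longrightarrow> Sup (range \<phi>\<^sub>2) = 1 \<Longrightarrow> c\<^sub>1 < c\<^sub>2"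
begin

text \<open>Both breakpoints belong to the piece on their left, which makes the jumps left
  continuous.\<close>

definition trunc :: "real \<Rightarrow> real \<Rightarrow> (real \<Rightarrow> real) \<Rightarrow> real \<Rightarrow> real" where
  "trunc c N u x = (if x \<le> - N then 0 else if x \<le> N then Qc c u x else 1)"

lemma trunc_in:
  assumes "0 \<le> N" "u \<in> classM" shows "trunc c N u \<in> classM"
proof -
  have "trunc c N u = (\<lambda>x. max (min (Qc c u x) (if x \<le> - N then 0 else 1)) (if x \<le> N then 0 else 1))"
    using classM_nonneg[OF Qc_in[OF assms(2)]] classM_le_1[OF Qc_in[OF assms(2)]] assms(1)
    by (auto simp: trunc_def fun_eq_iff)
  also have "\<dots> \<in> classM" by (intro classM_max classM_min classM_step Qc_in assms(2)) auto
  finally show ?thesis .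
qed

lemma trunc_fixed_point:
  assumes "0 \<le> N" and p: "p \<in> classM" "p \<le> trunc c N p" and q: "q \<in> classM" "trunc c N q \<le> q" and pq: "p \<le> q"
  obtains u where "u \<in> classM" "p \<le> u" "u \<le> q" "trunc c N u = u"
proof (rule classM_fixed_point[of "trunc c N", OF _ _ p q pq])
  show "trunc c N u \<in> classM" if "u \<in> classM" for u by (rule trunc_in[OF assms(1) that])
  show "trunc c N u \<le> trunc c N v" if "u \<in> classM" "v \<in> classM" "u \<le> v" for u v
    using Qc_mono[OF that, of c] by (auto simp: le_fun_def trunc_def)
qed (rule that)

text \<open>The prescribed value \<open>0\<close> lies below \<open>Qc\<close> and the prescribed
  value \<open>1\<close> above it. Hence the subsolution inequality can fail only beyond
  \<open>N k\<close> and the supersolution inequality only up to \<open>- N k\<close>: each asks the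
  centre \<open>z k\<close> to stay clear of one end.\<close>

lemma trunc_limit:
  fixes N z c :: "nat \<Rightarrow> real"
  assumes \<phi>: "\<And>k. \<phi> k \<in> classM" "\<And>k. trunc (c k) (N k) (\<phi> k) = \<phi> k" and c: "c \<longlonglongrightarrow> c0"
  obtains r u where "strict_mono r" "u \<in> classM" "wconv (\<lambda>k y. \<phi> (r k) (y + z (r k))) u"
    "\<forall>a x. a < x \<longrightarrow> (\<forall>y. a < y \<longrightarrow> y < x \<longrightarrow> (\<forall>\<^sub>F k in sequentially. y + z k \<le> N k)) \<longrightarrow> u x \<le> Qc c0 u x"
    "\<forall>a x. a < x \<longrightarrow> (\<forall>y. a < y \<longrightarrow> y < x \<longrightarrow> (\<forall>\<^sub>F k in sequentially. - N k < y + z k)) \<longrightarrow> Qc c0 u x \<le> u x"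
proof -
  define us where "us k = shiftT (- z k) (\<phi> k)" for k
  have us: "us k \<in> classM" for k unfolding us_def by (rule classM_shift[OF \<phi>(1)])
  have us_eq: "us k y = \<phi> k (y + z k)" "Qc d (us k) y = Qc d (\<phi> k) (y + z k)" for k y d
    unfolding us_def Qc_shift[OF \<phi>(1)] by (simp_all add: shiftT_def)
  have \<phi>_eq: "\<phi> k x = (if x \<le> - N k then 0 else if x \<le> N k then Qc (c k) (\<phi> k) x else 1)" for k x
    using fun_cong[OF \<phi>(2)[of k], of x] by (simp add: trunc_def)
  have bounds: "0 \<le> Qc (c k) (\<phi> k) x" "Qc (c k) (\<phi> k) x \<le> 1" for k x
    using classM_nonneg[OF Qc_in[OF \<phi>(1)]] classM_le_1[OF Qc_in[OF \<phi>(1)]] by auto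
  obtain r u where r: "strict_mono r" and u: "u \<in> classM" and w: "wconv (\<lambda>k. us (r k)) u"
    and wQ: "wconv (\<lambda>k. Qc (c (r k)) (us (r k))) (Qc c0 u)"
    by (rule limit_profile[OF us c])
  show thesis
  proof (rule that[OF r u]; (intro allI impI)?)
    show "wconv (\<lambda>k y. \<phi> (r k) (y + z (r k))) u" using w by (simp add: us_eq[abs_def])
    fix a x :: real assume ax: "a < x"
    {
      assume *: "\<forall>y. a < y \<longrightarrow> y < x \<longrightarrow> (\<forall>\<^sub>F k in sequentially. y + z k \<le> N k)"
      show "u x \<le> Qc c0 u x"
      proof (rule wconv_le[OF u w wQ ax])
        fix y e :: real assume "a < y" "y < x" "e > 0"
        from eventually_subseq[OF r *[rule_format, OF this(1,2)]]
        show "\<forall>\<^sub>F k in sequentially. us (r k) y \<le> Qc (c (r k)) (us (r k)) y + e"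
        proof eventually_elim
          case (elim k)
          then show ?case using \<phi>_eq[of "r k" "y + z (r k)"] bounds(1)[of "r k" "y + z (r k)"] \<open>e > 0\<close>
            by (auto simp: us_eq split: if_splits)
        qed
      qed
    next
      assume *: "\<forall>y. a < y \<longrightarrow> y < x \<longrightarrow> (\<forall>\<^sub>F k in sequentially. - N k < y + z k)"
      show "Qc c0 u x \<le> u x"
      proof (rule wconv_le[OF Qc_in[OF u] wQ w ax])
        fix y e :: real assume "a < y" "y < x" "e > 0"
        from eventually_subseq[OF r *[rule_format, OF this(1,2)]]
        show "\<forall>\<^sub>F k in sequentially. Qc (c (r k)) (us (r k)) y \<le> us (r k) y + e"
        proof eventually_elim
          case (elim k)
          then show ?case using \<phi>_eq[of "r k" "y + z (r k)"] bounds(2)[of "r k" "y + z (r k)"] \<open>e > 0\<close>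
            by (auto simp: us_eq split: if_splits)
        qed
      qed
    }
  qed
qed

definition level :: "(real \<Rightarrow> real) \<Rightarrow> real \<Rightarrow> real \<Rightarrow> bool" where
  "level u b z \<longleftrightarrow> (\<forall>x\<le>z. u x \<le> b) \<and> (\<forall>x>z. b < u x)"

lemma levelD: "level u b z \<Longrightarrow> x \<le> z \<Longrightarrow> u x \<le> b" "level u b z \<Longrightarrow> z < x \<Longrightarrow> b \<le> u x"
  by (auto simp: level_def)

text \<open>The prescribed values \<open>0\<close> and \<open>1\<close> force every intermediate
  level to be crossed inside \<open>[-N, N]\<close>.\<close>

lemma trunc_level:
  assumes \<phi>: "\<phi> \<in> classM" "trunc c N \<phi> = \<phi>" and N: "0 \<le> N" and b: "0 < b" "b < 1"
  obtains z where "level \<phi> b z" "- N \<le> z" "z \<le> N"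
proof -
  have *: "\<phi> x = (if x \<le> - N then 0 else if x \<le> N then Qc c \<phi> x else 1)" for x
    using fun_cong[OF \<phi>(2), of x] by (simp add: trunc_def)
  have l: "\<phi> (- N) = 0" and h: "\<And>x. N < x \<Longrightarrow> \<phi> x = 1" using * N by simp_all
  obtain z where z: "\<phi> z \<le> b" "\<And>x. z < x \<Longrightarrow> b < \<phi> x"
    using classM_level[OF \<phi>(1), of "- N" b "N + 1"] l h b by auto
  show thesis
  proof (rule that[of z])
    show "level \<phi> b z" using z classM_mono[OF \<phi>(1)] unfolding level_def by (meson order_trans)
    show "- N \<le> z" using z(2)[of "- N"] l b by force
    show "z \<le> N" using z(1) h[of z] b by force
  qed
qed

section \<open>Profiles as the truncation interval grows\<close>

context
  fixes b\<^sub>1 b\<^sub>2 :: real and N c :: "nat \<Rightarrow> real" and c0 :: real and \<phi> :: "nat \<Rightarrow> real \<Rightarrow> real"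
  assumes levels: "0 < b\<^sub>1" "b\<^sub>1 < \<alpha>" "\<alpha> < b\<^sub>2" "b\<^sub>2 < 1"
    and c: "c \<longlonglongrightarrow> c0"
    and \<phi>: "\<And>k. \<phi> k \<in> classM" "\<And>k. trunc (c k) (N k) (\<phi> k) = \<phi> k"
begin

text \<open>If the two levels drift apart, the profiles split into a wave from \<open>0\<close> to \<open>\<alpha>\<close> and a wave from
  \<open>\<alpha>\<close> to \<open>1\<close> of the same speed.\<close>

lemma level_gap_not_at_top:
  assumes x: "\<And>k. level (\<phi> k) b\<^sub>1 (x k)" "\<And>k. - N k \<le> x k"
    and y: "\<And>k. level (\<phi> k) b\<^sub>2 (y k)" "\<And>k. y k \<le> N k"
  shows "\<not> filterlim (\<lambda>k. y k - x k) at_top sequentially"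
proof
  assume gap: "filterlim (\<lambda>k. y k - x k) at_top sequentially"
  have ev: "\<forall>\<^sub>F k in sequentially. w < y k - x k" for w
    using gap by (simp add: filterlim_at_top_dense)
  obtain r u where r: "strict_mono r" and u: "u \<in> classM" and w: "wconv (\<lambda>k t. \<phi> (r k) (t + x (r k))) u"
    and sub': "\<forall>a t. a < t \<longrightarrow> (\<forall>s. a < s \<longrightarrow> s < t \<longrightarrow> (\<forall>\<^sub>F k in sequentially. s + x k \<le> N k)) \<longrightarrow> u t \<le> Qc c0 u t"
    and super': "\<forall>a t. a < t \<longrightarrow> (\<forall>s. a < s \<longrightarrow> s < t \<longrightarrow> (\<forall>\<^sub>F k in sequentially. - N k < s + x k)) \<longrightarrow> Qc c0 u t \<le> u t"
    by (rule trunc_limit[OF \<phi> c, where z = x])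
  \<comment> \<open>Seen from \<open>x k\<close>, the right end lies beyond \<open>y k\<close> and
    recedes to infinity. The left end may stay close, so the other inequality is obtained for
    positive \<open>t\<close> only.\<close>
  have sub: "u t \<le> Qc c0 u t" for t
  proof (rule sub'[rule_format, of "t - 1"])
    show "\<forall>\<^sub>F k in sequentially. s + x k \<le> N k" for s
      using ev[of s]
    proof eventually_elim
      case (elim k)
      then show ?case using y(2)[of k] by linarith
    qed
  qed simp
  have super: "Qc c0 u t \<le> u t" if "0 < t" for t
  proof (rule super'[rule_format, OF that])
    show "\<forall>\<^sub>F k in sequentially. - N k < s + x k" if "0 < s" for s
      using x(2) that by (auto intro!: always_eventually add_strict_increasing)
  qed
  have u0: "u 0 \<le> b\<^sub>1"
    by (rule wconv_bounds(1)[OF u w]) (auto intro!: always_eventually levelD(1)[OF x(1)])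
  have u1: "b\<^sub>1 \<le> u 1"
    by (rule wconv_bounds(2)[OF u w, of 0]) (auto intro!: always_eventually levelD(2)[OF x(1)])
  have u2: "u t \<le> b\<^sub>2" for t
  proof (rule wconv_bounds(1)[OF u w])
    show "\<forall>\<^sub>F k in sequentially. \<phi> (r k) (s + x (r k)) \<le> b\<^sub>2" for s
      using eventually_subseq[OF r ev[of s]] by eventually_elim (auto intro: levelD(1)[OF y(1)])
  qed
  have "Sup (range u) \<le> b\<^sub>2" using u2 by (auto intro: cSUP_least)
  \<comment> \<open>The subsolution exceeds \<open>0\<close> at \<open>1\<close>, so its limit is at
    least \<open>\<alpha>\<close>; the supersolution inequality on the right and the bound
    \<open>b\<^sub>2 < 1\<close> make it at most \<open>\<alpha>\<close>.\<close>
  then have Sup_u: "Sup (range u) = \<alpha>"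
    using Sup_dichotomy(1)[OF u, of 0 c0] Sup_dichotomy(2)[OF u super] sub u1
      classM_le_Sup[OF u, of 1] levels by force
  have "Inf (range u) < \<alpha>" using classM_Inf_le[OF u, of 0] u0 levels by linarith
  then obtain \<phi>\<^sub>1 where \<phi>\<^sub>1: "\<phi>\<^sub>1 \<in> classM" "Qc c0 \<phi>\<^sub>1 = \<phi>\<^sub>1" "Inf (range \<phi>\<^sub>1) = 0" "Sup (range \<phi>\<^sub>1) = \<alpha>"
    using lower_wave_of_subsolution[OF u sub Sup_u] by blast
  \<comment> \<open>Recentring at the upper crossing exchanges the roles: now the left end recedes,
    and the right end may stay close.\<close>
  obtain r v where r: "strict_mono r" and v: "v \<in> classM" and w: "wconv (\<lambda>k t. \<phi> (r k) (t + y (r k))) v"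
    and sub': "\<forall>a t. a < t \<longrightarrow> (\<forall>s. a < s \<longrightarrow> s < t \<longrightarrow> (\<forall>\<^sub>F k in sequentially. s + y k \<le> N k)) \<longrightarrow> v t \<le> Qc c0 v t"
    and super': "\<forall>a t. a < t \<longrightarrow> (\<forall>s. a < s \<longrightarrow> s < t \<longrightarrow> (\<forall>\<^sub>F k in sequentially. - N k < s + y k)) \<longrightarrow> Qc c0 v t \<le> v t"
    by (rule trunc_limit[OF \<phi> c, where z = y])
  have super: "Qc c0 v t \<le> v t" for t
  proof (rule super'[rule_format, of "t - 1"])
    show "\<forall>\<^sub>F k in sequentially. - N k < s + y k" for s
      using ev[of "- s"]
    proof eventually_elim
      case (elim k)
      then show ?case using x(2)[of k] by linarith
    qed
  qed simp
  have sub: "v t \<le> Qc c0 v t" if "t < 0" for t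
  proof (rule sub'[rule_format, of "t - 1"])
    show "\<forall>\<^sub>F k in sequentially. s + y k \<le> N k" if "s < t" for s
      using y(2) \<open>t < 0\<close> that by (auto intro!: always_eventually add_decreasing)
  qed simp
  have v0: "v 0 \<le> b\<^sub>2"
    by (rule wconv_bounds(1)[OF v w]) (auto intro!: always_eventually levelD(1)[OF y(1)])
  have v1: "b\<^sub>2 \<le> v 1"
    by (rule wconv_bounds(2)[OF v w, of 0]) (auto intro!: always_eventually levelD(2)[OF y(1)])
  have v2: "b\<^sub>1 \<le> v t" for t
  proof (rule wconv_bounds(2)[OF v w, of "t - 1"])
    show "\<forall>\<^sub>F k in sequentially. b\<^sub>1 \<le> \<phi> (r k) (s + y (r k))" for s
      using eventually_subseq[OF r ev[of "- s"]] by eventually_elim (auto intro: levelD(2)[OF x(1)])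
  qed simp
  have "b\<^sub>1 \<le> Inf (range v)" using v2 by (auto intro: cINF_greatest)
  then have Inf_v: "Inf (range v) = \<alpha>"
    using Inf_dichotomy(1)[OF v sub] Inf_dichotomy(2)[OF v, of 0 c0] super v0
      classM_Inf_le[OF v, of 0] levels by force
  have "\<alpha> < Sup (range v)" using classM_le_Sup[OF v, of 1] v1 levels by linarith
  then obtain \<phi>\<^sub>2 where "\<phi>\<^sub>2 \<in> classM" "Qc c0 \<phi>\<^sub>2 = \<phi>\<^sub>2" "Inf (range \<phi>\<^sub>2) = \<alpha>" "Sup (range \<phi>\<^sub>2) = 1"
    using upper_wave_of_supersolution[OF v super Inf_v] by blast
  then show False using speeds[OF \<phi>\<^sub>1] by blast
qed

end

context
  fixes b\<^sub>1 b\<^sub>2 :: real and N c :: "nat \<Rightarrow> real" and c0 :: real and \<phi> :: "nat \<Rightarrow> real \<Rightarrow> real"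
  assumes levels: "0 < b\<^sub>1" "b\<^sub>1 < \<alpha>" "\<alpha> < b\<^sub>2" "b\<^sub>2 < 1"
    and N: "filterlim N at_top sequentially" "\<And>k. 0 \<le> N k" and c: "c \<longlonglongrightarrow> c0"
    and \<phi>: "\<And>k. \<phi> k \<in> classM" "\<And>k. trunc (c k) (N k) (\<phi> k) = \<phi> k"
begin

text \<open>Of the two cases for the gap, divergence along a subsequence is excluded by
  \<open>level_gap_not_at_top\<close>.\<close>

lemma bounded_level_gap:
  obtains r :: "nat \<Rightarrow> nat" and x y :: "nat \<Rightarrow> real" and C where "strict_mono r" "\<forall>k. level (\<phi> (r k)) b\<^sub>1 (x k) \<and> - N (r k) \<le> x k"
    "\<forall>k. level (\<phi> (r k)) b\<^sub>2 (y k) \<and> y k \<le> N (r k)" "\<forall>k. x k \<le> y k \<and> y k - x k \<le> C"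
proof -
  have "\<exists>z. level (\<phi> k) b\<^sub>1 z \<and> - N k \<le> z" "\<exists>z. level (\<phi> k) b\<^sub>2 z \<and> z \<le> N k" for k
    using trunc_level[OF \<phi>(1,2) N(2), of b\<^sub>1 k] trunc_level[OF \<phi>(1,2) N(2), of b\<^sub>2 k] levels alpha
    by (metis less_trans)+
  then obtain x y where x: "\<And>k. level (\<phi> k) b\<^sub>1 (x k)" "\<And>k. - N k \<le> x k"
    and y: "\<And>k. level (\<phi> k) b\<^sub>2 (y k)" "\<And>k. y k \<le> N k"
    by metis
  have xy: "x k \<le> y k" for k
  proof (rule ccontr)
    assume "\<not> x k \<le> y k"
    then have "b\<^sub>2 < \<phi> k (x k)" using y(1)[of k] by (simp add: level_def)
    then show False using levelD(1)[OF x(1)[of k] order_refl] levels by linarith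
  qed
  show thesis
  proof (cases rule: real_subseq_cases[of "\<lambda>k. y k - x k"])
    case (1 r)
    have "(\<lambda>k. c (r k)) \<longlonglongrightarrow> c0" using LIMSEQ_subseq_LIMSEQ[OF c 1(1)] by (simp add: comp_def)
    then show thesis
      using level_gap_not_at_top[OF levels, of "\<lambda>k. c (r k)" c0 "\<lambda>k. \<phi> (r k)"
          "\<lambda>k. N (r k)" "\<lambda>k. x (r k)" "\<lambda>k. y (r k)"] \<phi> x y 1(2) by blast
  next
    case (2 r C)
    show thesis by (rule that[of r "\<lambda>k. x (r k)" "\<lambda>k. y (r k)" C]) (use x y xy 2 in auto)
  qed
qed

text \<open>Since the profiles exceed \<open>b\<^sub>2\<close> at the origin, the crossings
  \<open>y k\<close> are negative and infinitely far from the right end, so the limit centred there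
  is a subsolution on the whole line. The bounded gap keeps both levels in view, and the dichotomies
  give the limits \<open>0\<close> and \<open>1\<close>.\<close>

lemma left_limit:
  assumes "\<And>k. b\<^sub>2 < \<phi> k 0"
  obtains w where "w \<in> classM" "Inf (range w) = 0" "Sup (range w) = 1" "w \<le> Qc c0 w"
    "Qc c0 w = w \<or> (\<exists>C. \<forall>x\<le>C. w x = 0)"
proof -
  note result = that
  obtain r :: "nat \<Rightarrow> nat" and x y :: "nat \<Rightarrow> real" and C where r: "strict_mono r"
    and x': "\<forall>k. level (\<phi> (r k)) b\<^sub>1 (x k) \<and> - N (r k) \<le> x k"
    and y': "\<forall>k. level (\<phi> (r k)) b\<^sub>2 (y k) \<and> y k \<le> N (r k)"
    and xy': "\<forall>k. x k \<le> y k \<and> y k - x k \<le> C"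
    by (rule bounded_level_gap)
  note x = x'[rule_format, THEN conjunct1] x'[rule_format, THEN conjunct2]
  note y = y'[rule_format, THEN conjunct1] y'[rule_format, THEN conjunct2]
  note xy = xy'[rule_format, THEN conjunct1] xy'[rule_format, THEN conjunct2]
  have y0: "y k < 0" for k using levelD(1)[OF y(1)[of k], of 0] assms[of "r k"] by force
  \<comment> \<open>\<open>alt\<close> records whether the left end recedes from the crossing, which
    gives a wave, or stays at bounded distance, which gives a profile vanishing on a
    half-line.\<close>
  have main: thesis
    if r': "strict_mono r'" and alt: "filterlim (\<lambda>k. N (r (r' k)) + y (r' k)) at_top sequentially \<or> (\<exists>D. \<forall>k. N (r (r' k)) + y (r' k) \<le> D)"
    for r'
  proof -
    have rr': "strict_mono (\<lambda>k. r (r' k))" using strict_mono_o[OF r r'] by (simp add: comp_def)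
    have c': "(\<lambda>k. c (r (r' k))) \<longlonglongrightarrow> c0" using LIMSEQ_subseq_LIMSEQ[OF c rr'] by (simp add: comp_def)
    have N': "\<forall>\<^sub>F k in sequentially. t < N (r (r' k))" for t
      using filterlim_subseq_at_top[OF N(1) rr'] by (simp add: filterlim_at_top_dense)
    obtain s u where s: "strict_mono s" and u: "u \<in> classM"
      and w: "wconv (\<lambda>k t. \<phi> (r (r' (s k))) (t + y (r' (s k)))) u"
      and sub': "\<forall>a t. a < t \<longrightarrow> (\<forall>s. a < s \<longrightarrow> s < t \<longrightarrow> (\<forall>\<^sub>F k in sequentially. s + y (r' k) \<le> N (r (r' k)))) \<longrightarrow> u t \<le> Qc c0 u t"
      and super': "\<forall>a t. a < t \<longrightarrow> (\<forall>s. a < s \<longrightarrow> s < t \<longrightarrow> (\<forall>\<^sub>F k in sequentially. - N (r (r' k)) < s + y (r' k))) \<longrightarrow> Qc c0 u t \<le> u t"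
      by (rule trunc_limit[OF \<phi> c', where z = "\<lambda>k. y (r' k)"])
    have sub: "u t \<le> Qc c0 u t" for t
    proof (rule sub'[rule_format, of "t - 1"])
      show "\<forall>\<^sub>F k in sequentially. s + y (r' k) \<le> N (r (r' k))" for s
        using N'[of s]
      proof eventually_elim
        case (elim k)
        then show ?case using y0[of "r' k"] by linarith
      qed
    qed simp
    have super: "Qc c0 u t \<le> u t" if "0 < t" for t
    proof (rule super'[rule_format, OF that])
      show "\<forall>\<^sub>F k in sequentially. - N (r (r' k)) < s + y (r' k)" if "0 < s" for s
      proof (rule always_eventually, rule)
        show "- N (r (r' k)) < s + y (r' k)" for k using x(2)[of "r' k"] xy(1)[of "r' k"] that by linarith
      qed
    qed
    have u1: "b\<^sub>2 \<le> u 1"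
      by (rule wconv_bounds(2)[OF u w, of 0]) (auto intro!: always_eventually levelD(2)[OF y(1)])
    \<comment> \<open>A point more than \<open>C\<close> to the left of \<open>y\<close> is also to
      the left of the lower crossing \<open>x\<close>.\<close>
    have u0: "u (- C) \<le> b\<^sub>1"
    proof (rule wconv_bounds(1)[OF u w], rule always_eventually, rule)
      show "\<phi> (r (r' (s k))) (t + y (r' (s k))) \<le> b\<^sub>1" if "t < - C" for t k
        using xy(2)[of "r' (s k)"] that by (intro levelD(1)[OF x(1)]) linarith
    qed
    have "Inf (range u) \<le> 0"
      using Inf_dichotomy(1)[OF u, of 0 c0] sub classM_Inf_le[OF u, of "- C"] u0 levels by force
    moreover have "0 \<le> Inf (range u)" by (auto intro: cINF_greatest classM_nonneg[OF u])
    moreover have "1 \<le> Sup (range u)"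
      using Sup_dichotomy(2)[OF u super] classM_le_Sup[OF u, of 1] u1 levels by force
    moreover have "Sup (range u) \<le> 1" by (auto intro: cSUP_least classM_le_1[OF u])
    moreover have "Qc c0 u = u \<or> (\<exists>C. \<forall>x\<le>C. u x = 0)"
      using alt
    proof
      assume *: "filterlim (\<lambda>k. N (r (r' k)) + y (r' k)) at_top sequentially"
      have "Qc c0 u t \<le> u t" for t
      proof (rule super'[rule_format, of "t - 1"])
        show "\<forall>\<^sub>F k in sequentially. - N (r (r' k)) < s + y (r' k)" for s
          using * unfolding filterlim_at_top_dense by (auto elim!: allE[of _ "- s"] eventually_mono)
      qed simp
      then show ?thesis using sub by (auto intro!: antisym simp: fun_eq_iff)
    next
      assume "\<exists>D. \<forall>k. N (r (r' k)) + y (r' k) \<le> D"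
      then obtain D where D: "\<And>k. N (r (r' k)) + y (r' k) \<le> D" by blast
      have "u (- D) \<le> 0"
      proof (rule wconv_bounds(1)[OF u w], rule always_eventually, rule)
        show "\<phi> (r (r' (s k))) (t + y (r' (s k))) \<le> 0" if "t < - D" for t k
          using fun_cong[OF \<phi>(2)[of "r (r' (s k))"], of "t + y (r' (s k))"] D[of "s k"] that
          by (auto simp: trunc_def split: if_splits)
      qed
      then have "u x = 0" if "x \<le> - D" for x
        using classM_mono[OF u that] classM_nonneg[OF u, of x] by linarith
      then show ?thesis by blast
    qed
    ultimately show thesis using sub by (intro result[of u] u) (auto simp: le_fun_def intro: antisym)
  qed
  show thesis
    by (cases rule: real_subseq_cases[of "\<lambda>k. N (r k) + y k"]) (blast intro: main)+
qed

text \<open>The mirror image: the crossings of \<open>b\<^sub>2\<close> are now nonnegative, hence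
  far from the left end, and the limit is a supersolution on the whole line.\<close>

lemma right_limit:
  assumes "\<And>k. \<phi> k 0 \<le> b\<^sub>2"
  obtains w where "w \<in> classM" "Inf (range w) = 0" "Sup (range w) = 1" "Qc c0 w \<le> w"
    "Qc c0 w = w \<or> (\<exists>C. \<forall>x>C. w x = 1)"
proof -
  note result = that
  obtain r :: "nat \<Rightarrow> nat" and x y :: "nat \<Rightarrow> real" and C where r: "strict_mono r"
    and x': "\<forall>k. level (\<phi> (r k)) b\<^sub>1 (x k) \<and> - N (r k) \<le> x k"
    and y': "\<forall>k. level (\<phi> (r k)) b\<^sub>2 (y k) \<and> y k \<le> N (r k)"
    and xy': "\<forall>k. x k \<le> y k \<and> y k - x k \<le> C"
    by (rule bounded_level_gap)
  note x = x'[rule_format, THEN conjunct1] x'[rule_format, THEN conjunct2]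
  note y = y'[rule_format, THEN conjunct1] y'[rule_format, THEN conjunct2]
  note xy = xy'[rule_format, THEN conjunct1] xy'[rule_format, THEN conjunct2]
  have y0: "0 \<le> y k" for k using y(1)[of k] assms[of "r k"] by (metis level_def not_le)
  have main: thesis
    if r': "strict_mono r'" and alt: "filterlim (\<lambda>k. N (r (r' k)) - y (r' k)) at_top sequentially \<or> (\<exists>D. \<forall>k. N (r (r' k)) - y (r' k) \<le> D)"
    for r'
  proof -
    have rr': "strict_mono (\<lambda>k. r (r' k))" using strict_mono_o[OF r r'] by (simp add: comp_def)
    have c': "(\<lambda>k. c (r (r' k))) \<longlonglongrightarrow> c0" using LIMSEQ_subseq_LIMSEQ[OF c rr'] by (simp add: comp_def)
    have N': "\<forall>\<^sub>F k in sequentially. t < N (r (r' k))" for t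
      using filterlim_subseq_at_top[OF N(1) rr'] by (simp add: filterlim_at_top_dense)
    obtain s u where s: "strict_mono s" and u: "u \<in> classM"
      and w: "wconv (\<lambda>k t. \<phi> (r (r' (s k))) (t + y (r' (s k)))) u"
      and sub': "\<forall>a t. a < t \<longrightarrow> (\<forall>s. a < s \<longrightarrow> s < t \<longrightarrow> (\<forall>\<^sub>F k in sequentially. s + y (r' k) \<le> N (r (r' k)))) \<longrightarrow> u t \<le> Qc c0 u t"
      and super': "\<forall>a t. a < t \<longrightarrow> (\<forall>s. a < s \<longrightarrow> s < t \<longrightarrow> (\<forall>\<^sub>F k in sequentially. - N (r (r' k)) < s + y (r' k))) \<longrightarrow> Qc c0 u t \<le> u t"
      by (rule trunc_limit[OF \<phi> c', where z = "\<lambda>k. y (r' k)"])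
    have super: "Qc c0 u t \<le> u t" for t
    proof (rule super'[rule_format, of "t - 1"])
      show "\<forall>\<^sub>F k in sequentially. - N (r (r' k)) < s + y (r' k)" for s
        using N'[of "- s"]
      proof eventually_elim
        case (elim k)
        then show ?case using y0[of "r' k"] by linarith
      qed
    qed simp
    have sub: "u t \<le> Qc c0 u t" if "t < 0" for t
    proof (rule sub'[rule_format, of "t - 1"])
      show "\<forall>\<^sub>F k in sequentially. s + y (r' k) \<le> N (r (r' k))" if "s < t" for s
      proof (rule always_eventually, rule)
        show "s + y (r' k) \<le> N (r (r' k))" for k using y(2)[of "r' k"] that \<open>t < 0\<close> by linarith
      qed
    qed simp
    have u1: "b\<^sub>2 \<le> u 1"
      by (rule wconv_bounds(2)[OF u w, of 0]) (auto intro!: always_eventually levelD(2)[OF y(1)])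
    have u0: "u (- C) \<le> b\<^sub>1"
    proof (rule wconv_bounds(1)[OF u w], rule always_eventually, rule)
      show "\<phi> (r (r' (s k))) (t + y (r' (s k))) \<le> b\<^sub>1" if "t < - C" for t k
        using xy(2)[of "r' (s k)"] that by (intro levelD(1)[OF x(1)]) linarith
    qed
    have "Inf (range u) \<le> 0"
      using Inf_dichotomy(1)[OF u sub] classM_Inf_le[OF u, of "- C"] u0 levels by force
    moreover have "0 \<le> Inf (range u)" by (auto intro: cINF_greatest classM_nonneg[OF u])
    moreover have "1 \<le> Sup (range u)"
      using Sup_dichotomy(2)[OF u, of 0 c0] super classM_le_Sup[OF u, of 1] u1 levels by force
    moreover have "Sup (range u) \<le> 1" by (auto intro: cSUP_least classM_le_1[OF u])
    moreover have "Qc c0 u = u \<or> (\<exists>C. \<forall>x>C. u x = 1)"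
      using alt
    proof
      assume *: "filterlim (\<lambda>k. N (r (r' k)) - y (r' k)) at_top sequentially"
      have "u t \<le> Qc c0 u t" for t
      proof (rule sub'[rule_format, of "t - 1"])
        show "\<forall>\<^sub>F k in sequentially. s + y (r' k) \<le> N (r (r' k))" for s
          using * unfolding filterlim_at_top_dense by (auto elim!: allE[of _ s] eventually_mono)
      qed simp
      then show ?thesis using super by (auto intro!: antisym simp: fun_eq_iff)
    next
      assume "\<exists>D. \<forall>k. N (r (r' k)) - y (r' k) \<le> D"
      then obtain D where D: "\<And>k. N (r (r' k)) - y (r' k) \<le> D" by blast
      \<comment> \<open>Seen from \<open>y\<close>, the prescribed value \<open>1\<close> begins at
        distance at most \<open>D\<close>; \<open>0 \<le> N\<close> rules out the branch with value
        \<open>0\<close>.\<close>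
      have "1 \<le> u x" if "D < x" for x
      proof (rule wconv_bounds(2)[OF u w that], rule always_eventually, rule)
        show "1 \<le> \<phi> (r (r' (s k))) (t + y (r' (s k)))" if "D < t" for t k
          using fun_cong[OF \<phi>(2)[of "r (r' (s k))"], of "t + y (r' (s k))"] D[of "s k"] that N(2)[of "r (r' (s k))"] y0[of "r' (s k)"]
          by (auto simp: trunc_def split: if_splits)
      qed
      then show ?thesis using classM_le_1[OF u] by (metis antisym)
    qed
    ultimately show thesis using super by (intro result[of u] u) (auto simp: le_fun_def intro: antisym)
  qed
  show thesis
    by (cases rule: real_subseq_cases[of "\<lambda>k. N (r k) - y k"]) (blast intro: main)+
qed

end

end

section \<open>Choice of the speeds and construction of the wave\<close>

lemma adjacent_points:
  fixes lo hi d :: real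
  assumes P: "P lo" and R: "R hi" and cover: "\<And>c. P c \<or> R c" and le: "lo \<le> hi" and d: "d > 0"
  obtains a b where "a \<in> {lo..hi}" "b \<in> {lo..hi}" "P a" "R b" "\<bar>a - b\<bar> < d"
proof -
  obtain m where m: "(hi - lo) / d < real m" using reals_Archimedean2 by blast
  define n where "n = Suc m"
  define h where "h = (hi - lo) / real n"
  have n: "0 < real n" by (simp add: n_def)
  have h: "0 \<le> h" "h < d"
  proof -
    show "0 \<le> h" using le n by (simp add: h_def)
    have "(hi - lo) / d < real n" using m by (simp add: n_def)
    then show "h < d" using d n by (simp add: h_def field_simps)
  qed
  define g where "g j = lo + real j * h" for j
  have g_in: "g j \<in> {lo..hi}" if "j \<le> n" for j
  proof -
    have "real j * h \<le> real n * h" using that h by (intro mult_right_mono) auto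
    moreover have "real n * h = hi - lo" using n by (simp add: h_def)
    moreover have "0 \<le> real j * h" using h by simp
    ultimately show ?thesis by (simp add: g_def)
  qed
  have gn: "R (g n)" using R n by (simp add: g_def h_def)
  \<comment> \<open>The grid point before the first one with \<open>R\<close> lacks
    \<open>R\<close>, so it has \<open>P\<close>, and the mesh is below \<open>d\<close>. If the
    first one is \<open>lo\<close>, both properties hold there.\<close>
  define j where "j = (LEAST j. R (g j))"
  have j: "R (g j)" "j \<le> n" "\<And>i. i < j \<Longrightarrow> \<not> R (g i)"
    using gn by (auto simp: j_def intro: LeastI Least_le dest: not_less_Least)
  show thesis
  proof (cases j)
    case 0
    then show thesis using that[of lo lo] P j(1) le d by (simp add: g_def)
  next
    case (Suc i)
    then have "P (g i)" using j(3)[of i] cover by auto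
    then show thesis
      using that[of "g i" "g j"] g_in[of i] g_in[of j] j Suc h by (simp add: g_def algebra_simps)
  qed
qed

context propagating_bistable_map begin

lemma wave_of_truncated_profiles:
  fixes N a b :: "nat \<Rightarrow> real"
  assumes levels: "\<alpha> < b\<^sub>2" "b\<^sub>2 < 1"
    and N: "filterlim N at_top sequentially" "\<And>k. 0 \<le> N k" and a: "a \<longlonglongrightarrow> c" and b: "b \<longlonglongrightarrow> c"
    and \<phi>: "\<And>k. \<phi> k \<in> classM" "\<And>k. trunc (a k) (N k) (\<phi> k) = \<phi> k" "\<And>k. b\<^sub>2 < \<phi> k 0"
    and \<psi>: "\<And>k. \<psi> k \<in> classM" "\<And>k. trunc (b k) (N k) (\<psi> k) = \<psi> k" "\<And>k. \<psi> k 0 \<le> b\<^sub>2"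
  obtains u where "u \<in> classM" "Inf (range u) = 0" "Sup (range u) = 1" "Qc c u = u"
proof -
  \<comment> \<open>The lower level may be any value in \<open>(0, \<alpha>)\<close>.\<close>
  have b1: "0 < \<alpha> / 2" "\<alpha> / 2 < \<alpha>" using alpha by auto
  obtain w where w: "w \<in> classM" "Inf (range w) = 0" "Sup (range w) = 1" "w \<le> Qc c w"
    and w_alt: "Qc c w = w \<or> (\<exists>C. \<forall>x\<le>C. w x = 0)"
    by (rule left_limit[OF b1 levels N a \<phi>])
  obtain v where v: "v \<in> classM" "Inf (range v) = 0" "Sup (range v) = 1" "Qc c v \<le> v"
    and v_alt: "Qc c v = v \<or> (\<exists>C. \<forall>x>C. v x = 1)"
    by (rule right_limit[OF b1 levels N b \<psi>])
  show thesis
  proof (cases "Qc c w = w \<or> Qc c v = v")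
    case True
    then show thesis using that w v by blast
  next
    case False
    then obtain C D where C: "\<And>x. x \<le> C \<Longrightarrow> w x = 0" and D: "\<And>x. D < x \<Longrightarrow> v x = 1"
      using w_alt v_alt by blast
    \<comment> \<open>This translate equals \<open>1\<close> to the right of \<open>C\<close>, and
      \<open>w\<close> vanishes up to \<open>C\<close>.\<close>
    define q where "q = shiftT (C - D) v"
    have q: "q \<in> classM" unfolding q_def by (rule classM_shift[OF v(1)])
    have Qq: "Qc c q \<le> q"
      using v(4) unfolding q_def Qc_shift[OF v(1)] by (simp add: le_fun_def shiftT_def)
    have wq: "w \<le> q"
    proof (rule le_funI)
      fix x show "w x \<le> q x"
        using C[of x] D[of "x - (C - D)"] classM_nonneg[OF q, of x] classM_le_1[OF w(1), of x]
        by (cases "x \<le> C") (auto simp: q_def shiftT_def)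
    qed
    obtain u where u: "u \<in> classM" "w \<le> u" "u \<le> q" "Qc c u = u"
      by (rule classM_fixed_point[of "Qc c", OF Qc_in Qc_mono w(1,4) q Qq wq])
    \<comment> \<open>The barriers fix the limits: \<open>q\<close> above forces \<open>0\<close> on
      the left, \<open>w\<close> below forces \<open>1\<close> on the right.\<close>
    have "Inf (range u) \<le> v x" for x
      using classM_Inf_le[OF u(1), of "x + (C - D)"] le_funD[OF u(3), of "x + (C - D)"]
      by (simp add: q_def shiftT_def)
    then have "Inf (range u) \<le> 0" unfolding v(2)[symmetric] by (auto intro: cINF_greatest)
    moreover have "0 \<le> Inf (range u)" by (auto intro: cINF_greatest classM_nonneg[OF u(1)])
    moreover have "w x \<le> Sup (range u)" for x
      using classM_le_Sup[OF u(1), of x] le_funD[OF u(2), of x] by simp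
    then have "1 \<le> Sup (range u)" unfolding w(3)[symmetric] by (auto intro: cSUP_least)
    moreover have "Sup (range u) \<le> 1" by (auto intro: cSUP_least classM_le_1[OF u(1)])
    ultimately show thesis using that u by auto
  qed
qed

text \<open>If \<open>c > d\<close>, each application of the map moves \<open>p\<close> a further
  \<open>c - d\<close> to the left while keeping it below \<open>q\<close>. After arbitrarily many
  steps every value of \<open>p\<close> lies below every value of \<open>q\<close>, against
  \<open>lim\<close>.\<close>

lemma sub_super_speed_le:
  assumes p: "p \<in> classM" "p \<le> Qc c p" and q: "q \<in> classM" "Qc d q \<le> q" and pq: "p \<le> q"
    and lim: "Inf (range q) < Sup (range p)"
  shows "c \<le> d"
proof (rule ccontr)
  assume "\<not> c \<le> d"
  define s where "s = c - d"
  have s: "s > 0" using \<open>\<not> c \<le> d\<close> by (simp add: s_def)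
  have "shiftT (- real n * s) p \<le> q" for n
  proof (induction n)
    case 0
    then show ?case using pq by (simp add: shiftT_def le_fun_def)
  next
    case (Suc n)
    show ?case
    proof (rule le_funI)
      fix x
      have "shiftT (- real (Suc n) * s) p x = p (x + real n * s + s)"
        by (simp add: shiftT_def algebra_simps)
      also have "\<dots> \<le> Qc c p (x + real n * s + s)" by (rule le_funD[OF p(2)])
      also have "\<dots> = Qc d p (x + real n * s)" by (simp add: Qc_def shiftT_def s_def algebra_simps)
      also have "\<dots> = Qc d (shiftT (- real n * s) p) x"
        unfolding Qc_shift[OF p(1)] by (simp add: shiftT_def)
      also have "\<dots> \<le> Qc d q x" by (rule le_funD[OF Qc_mono[OF classM_shift[OF p(1)] q(1) Suc]])
      also have "\<dots> \<le> q x" by (rule le_funD[OF q(2)])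
      finally show "shiftT (- real (Suc n) * s) p x \<le> q x" .
    qed
  qed
  then have le: "p (x + real n * s) \<le> q x" for n x by (force simp: le_fun_def shiftT_def)
  have "p y \<le> q x" for x y
  proof -
    obtain n where "(y - x) / s < real n" using reals_Archimedean2 by blast
    then have "y \<le> x + real n * s" using s by (simp add: field_simps)
    then show ?thesis using classM_mono[OF p(1)] le order_trans by blast
  qed
  then have "Sup (range p) \<le> q x" for x by (auto intro: cSUP_least)
  then have "Sup (range p) \<le> Inf (range q)" by (auto intro: cINF_greatest)
  then show False using lim by simp
qed

text \<open>The normalisations \<open>p 0 = 0\<close> and \<open>q 0 = 1\<close> act twice: they
  order \<open>p\<close> below \<open>q\<close>, hence the two speeds, and they make translates by
  \<open>N k\<close> compatible with the prescribed values.\<close>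

lemma bistable_wave_exists:
  assumes p: "p \<in> classM" "p 0 = 0" "p \<le> Qc c_lo p" "\<alpha> < Sup (range p)"
    and q: "q \<in> classM" "q 0 = 1" "Qc c_hi q \<le> q" "Inf (range q) < \<alpha>"
  obtains c u where "c \<in> {c_lo..c_hi}" "u \<in> classM" "Inf (range u) = 0" "Sup (range u) = 1" "Qc c u = u"
proof -
  have p0: "p x = 0" if "x \<le> 0" for x
    using classM_mono[OF p(1) that] classM_nonneg[OF p(1), of x] p(2) by simp
  have q1: "q x = 1" if "0 \<le> x" for x
    using classM_mono[OF q(1) that] classM_le_1[OF q(1), of x] q(2) by simp
  have "p \<le> q"
  proof (rule le_funI)
    fix x show "p x \<le> q x"
      using p0[of x] q1[of x] classM_nonneg[OF q(1), of x] classM_le_1[OF p(1), of x] by (cases "x \<le> 0") auto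
  qed
  then have le: "c_lo \<le> c_hi"
    by (rule sub_super_speed_le[OF p(1,3) q(1,3)]) (use p q in linarith)
  \<comment> \<open>Above \<open>\<alpha>\<close>, yet low enough for a translate of
    \<open>p\<close> to exceed it at the origin.\<close>
  define b where "b = (\<alpha> + Sup (range p)) / 2"
  have "Sup (range p) \<le> 1" by (auto intro: cSUP_least classM_le_1[OF p(1)])
  then have b: "\<alpha> < b" "b < 1" "b < Sup (range p)" using p(4) alpha by (auto simp: b_def)
  obtain x0 where x0: "b < p x0" using b less_cSup_iff[OF _ classM_bdd(1)[OF p(1)]] by auto
  obtain x1 where x1: "q x1 < \<alpha>" using q(4) cInf_less_iff[OF _ classM_bdd(2)[OF q(1)]] by auto
  \<comment> \<open>\<open>N k\<close> dominates both \<open>x0\<close> and \<open>- x1\<close>: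
    \<open>p\<close> shifted left by \<open>N k\<close> exceeds \<open>b\<close> at the origin, and
    \<open>q\<close> shifted right by \<open>N k\<close> is below \<open>\<alpha>\<close>
    there.\<close>
  define N where "N k = real k + \<bar>x0\<bar> + \<bar>x1\<bar>" for k
  have N: "filterlim N at_top sequentially" "\<And>k. 0 \<le> N k"
  proof -
    have "filterlim (\<lambda>k. \<bar>x0\<bar> + \<bar>x1\<bar> + real k) at_top sequentially"
      by (rule filterlim_tendsto_add_at_top[OF tendsto_const filterlim_real_sequentially])
    then show "filterlim N at_top sequentially" by (simp add: N_def[abs_def] algebra_simps)
  qed (simp add: N_def)
  define F where "F k c u \<longleftrightarrow> u \<in> classM \<and> trunc c (N k) u = u" for k c u
  have zero: "(\<lambda>_. 0) \<in> classM" and one: "(\<lambda>_. 1) \<in> classM" by (simp_all add: classM_const)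
  have trunc_0: "(\<lambda>_. 0) \<le> trunc c (N k) (\<lambda>_. 0)" for c k
    using classM_nonneg[OF Qc_in[OF zero]] by (auto simp: le_fun_def trunc_def)
  have trunc_1: "trunc c (N k) (\<lambda>_. 1) \<le> (\<lambda>_. 1)" for c k
    using classM_le_1[OF Qc_in[OF one]] by (auto simp: le_fun_def trunc_def)
  have lo: "\<exists>u. F k c_lo u \<and> b < u 0" for k
  proof -
    \<comment> \<open>It vanishes up to \<open>- N k\<close>, where the truncation prescribes
      \<open>0\<close>, and so remains a subsolution of the truncated problem.\<close>
    define p' where "p' = shiftT (- N k) p"
    have p': "p' \<in> classM" unfolding p'_def by (rule classM_shift[OF p(1)])
    have Qp': "p' \<le> Qc c_lo p'"
      using p(3) unfolding p'_def Qc_shift[OF p(1)] by (simp add: le_fun_def shiftT_def)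
    have 1: "p' \<le> trunc c_lo (N k) p'"
    proof (rule le_funI)
      fix x show "p' x \<le> trunc c_lo (N k) p' x"
        using le_funD[OF Qp', of x] classM_le_1[OF p', of x] p0[of "x + N k"]
        by (auto simp: trunc_def p'_def[unfolded shiftT_def])
    qed
    have 2: "p' \<le> (\<lambda>_. 1)" using classM_le_1[OF p'] by (simp add: le_fun_def)
    obtain u where u: "u \<in> classM" "p' \<le> u" "trunc c_lo (N k) u = u"
      using trunc_fixed_point[OF N(2) p' 1 one trunc_1 2] by metis
    have "x0 \<le> N k" by (simp add: N_def)
    then have "p x0 \<le> p' 0" using classM_mono[OF p(1), of x0 "N k"] by (simp add: p'_def shiftT_def)
    then show ?thesis using u x0 le_funD[OF u(2), of 0] by (auto simp: F_def)
  qed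
  have hi: "\<exists>u. F k c_hi u \<and> u 0 \<le> b" for k
  proof -
    define q' where "q' = shiftT (N k) q"
    have q': "q' \<in> classM" unfolding q'_def by (rule classM_shift[OF q(1)])
    have Qq': "Qc c_hi q' \<le> q'"
      using q(3) unfolding q'_def Qc_shift[OF q(1)] by (simp add: le_fun_def shiftT_def)
    have 1: "trunc c_hi (N k) q' \<le> q'"
    proof (rule le_funI)
      fix x show "trunc c_hi (N k) q' x \<le> q' x"
        using le_funD[OF Qq', of x] classM_nonneg[OF q', of x] q1[of "x - N k"]
        by (auto simp: trunc_def q'_def[unfolded shiftT_def])
    qed
    have 2: "(\<lambda>_. 0) \<le> q'" using classM_nonneg[OF q'] by (simp add: le_fun_def)
    obtain u where u: "u \<in> classM" "u \<le> q'" "trunc c_hi (N k) u = u"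
      using trunc_fixed_point[OF N(2) zero trunc_0 q' 1 2] by metis
    have "- N k \<le> x1" by (simp add: N_def)
    then have "q' 0 \<le> q x1" using classM_mono[OF q(1), of "- N k" x1] by (simp add: q'_def shiftT_def)
    then show ?thesis using u x1 le_funD[OF u(2), of 0] b by (auto simp: F_def)
  qed
  \<comment> \<open>A truncated solution between \<open>0\<close> and \<open>1\<close> exists for
    every speed, and its value at the origin is on one side of \<open>b\<close>.\<close>
  have cover: "(\<exists>u. F k c u \<and> b < u 0) \<or> (\<exists>u. F k c u \<and> u 0 \<le> b)" for k c
  proof -
    have "(\<lambda>_. 0::real) \<le> (\<lambda>_::real. 1)" by (simp add: le_fun_def)
    then obtain u where "u \<in> classM" "trunc c (N k) u = u"
      using trunc_fixed_point[OF N(2) zero trunc_0 one trunc_1] by metis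
    then show ?thesis unfolding F_def by (metis not_le)
  qed
  have "\<exists>x y. x \<in> {c_lo..c_hi} \<and> y \<in> {c_lo..c_hi} \<and> (\<exists>u. F k x u \<and> b < u 0) \<and> (\<exists>u. F k y u \<and> u 0 \<le> b)
      \<and> \<bar>x - y\<bar> < inverse (real (Suc k))" for k
    by (rule adjacent_points[of "\<lambda>c. \<exists>u. F k c u \<and> b < u 0" c_lo "\<lambda>c. \<exists>u. F k c u \<and> u 0 \<le> b" c_hi "inverse (real (Suc k))",
          OF lo hi cover le]) (simp, blast)
  then obtain x y \<phi> \<psi> where x: "\<And>k. x k \<in> {c_lo..c_hi}" and xy: "\<And>k. \<bar>x k - y k\<bar> < inverse (real (Suc k))"
    and \<phi>: "\<And>k. F k (x k) (\<phi> k)" "\<And>k. b < \<phi> k 0" and \<psi>: "\<And>k. F k (y k) (\<psi> k)" "\<And>k. \<psi> k 0 \<le> b"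
    by metis
  \<comment> \<open>Compactness gives a limit speed in the required interval; the second family of
    speeds has the same limit because the distances vanish.\<close>
  obtain c r where c: "c \<in> {c_lo..c_hi}" and r: "strict_mono (r :: nat \<Rightarrow> nat)" and lim: "(x \<circ> r) \<longlonglongrightarrow> c"
    using seq_compactE[OF compact_imp_seq_compact[OF compact_Icc]] x by metis
  have "(\<lambda>k. y k - x k) \<longlonglongrightarrow> 0"
    by (rule tendsto_rabs_zero_cancel, rule tendsto_sandwich[OF _ _ tendsto_const LIMSEQ_inverse_real_of_nat])
      (auto intro!: always_eventually less_imp_le simp: abs_minus_commute xy simp del: of_nat_Suc)
  from tendsto_add[OF lim LIMSEQ_subseq_LIMSEQ[OF this r]]
  have limy: "(\<lambda>k. y (r k)) \<longlonglongrightarrow> c" by (simp add: comp_def)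
  have limx: "(\<lambda>k. x (r k)) \<longlonglongrightarrow> c" using lim by (simp add: comp_def)
  show thesis
    by (rule wave_of_truncated_profiles[OF b(1,2) filterlim_subseq_at_top[OF N(1) r] N(2) limx limy,
          of "\<lambda>k. \<phi> (r k)" "\<lambda>k. \<psi> (r k)"])
      (use \<phi> \<psi> that[OF c] in \<open>auto simp: F_def\<close>)
qed

end

section \<open>Translation between limits at infinity and \<open>Inf\<close>, \<open>Sup\<close> of
  the range\<close>

lemma classM_Sup_eqI: "u \<in> classM \<Longrightarrow> (u \<longlongrightarrow> L) at_top \<Longrightarrow> Sup (range u) = L"
  using tendsto_unique[OF _ classM_tendsto_top] by force

lemma classM_Inf_eqI: "u \<in> classM \<Longrightarrow> (u \<longlongrightarrow> L) at_bot \<Longrightarrow> Inf (range u) = L"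
  using tendsto_unique[OF _ classM_tendsto_bot] by force

theorem theorem4:
  fixes Q0 :: "(real \<Rightarrow> real) \<Rightarrow> (real \<Rightarrow> real)"
    and \<alpha> c_lo c_hi :: real
    and psi_lo psi_hi :: "real \<Rightarrow> real"
  assumes Q0_maps: "\<forall>u\<in>classM. Q0 u \<in> classM"
    and alpha: "0 < \<alpha>" "\<alpha> < 1"
    and hyp_i: "\<forall>us u. (\<forall>k. us k \<in> classM) \<longrightarrow> u \<in> classM \<longrightarrow> unif_conv_bounded us u \<longrightarrow>
                  (AE x in lborel. (\<lambda>k. Q0 (us k) x) \<longlonglongrightarrow> Q0 u x)"
    and hyp_ii: "\<forall>u1\<in>classM. \<forall>u2\<in>classM. (\<forall>x. u1 x \<le> u2 x) \<longrightarrow> (\<forall>x. Q0 u1 x \<le> Q0 u2 x)"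
    and hyp_iii: "\<forall>x0. \<forall>u\<in>classM. shiftT x0 (Q0 u) = Q0 (shiftT x0 u)"
    and hyp_iv_a: "Q0 (\<lambda>_. \<alpha>) = (\<lambda>_. \<alpha>)"
    and hyp_iv_b: "\<forall>\<gamma>. 0 < \<gamma> \<and> \<gamma> < \<alpha> \<longrightarrow> (\<forall>x. Q0 (\<lambda>_. \<gamma>) x < \<gamma>)"
    and hyp_iv_c: "\<forall>\<gamma>. \<alpha> < \<gamma> \<and> \<gamma> < 1 \<longrightarrow> (\<forall>x. \<gamma> < Q0 (\<lambda>_. \<gamma>) x)"
    and hyp_v: "\<forall>cm cp phim phip.
       phim \<in> classM \<and> phip \<in> classM \<and>
       (\<forall>x. Q0 phim (x - cm) = phim x) \<and> (phim \<longlongrightarrow> 0) at_bot \<and> (phim \<longlongrightarrow> \<alpha>) at_top \<and>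
       (\<forall>x. Q0 phip (x - cp) = phip x) \<and> (phip \<longlongrightarrow> \<alpha>) at_bot \<and> (phip \<longlongrightarrow> 1) at_top
       \<longrightarrow> cm < cp"
    and sub: "psi_lo \<in> classM" "psi_lo 0 = 0"
      "\<exists>L. (psi_lo \<longlongrightarrow> L) at_top \<and> \<alpha> < L \<and> L \<le> 1"
      "\<forall>x. psi_lo x \<le> Q0 psi_lo (x - c_lo)"
    and super: "psi_hi \<in> classM" "psi_hi 0 = 1"
      "\<exists>L. (psi_hi \<longlongrightarrow> L) at_bot \<and> 0 \<le> L \<and> L < \<alpha>"
      "\<forall>x. Q0 psi_hi (x - c_hi) \<le> psi_hi x"
  shows "\<exists>c\<in>{c_lo..c_hi}. \<exists>\<phi>\<in>classM. (\<phi> \<longlongrightarrow> 0) at_bot \<and> (\<phi> \<longlongrightarrow> 1) at_top \<and>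
           (\<forall>x. Q0 \<phi> (x - c) = \<phi> x)"
proof -
  interpret bistable_map Q0 \<alpha>
    by unfold_locales (use Q0_maps alpha hyp_i hyp_ii hyp_iii hyp_iv_a hyp_iv_b hyp_iv_c in \<open>auto simp: le_fun_def\<close>)
  have Qc_eq: "Qc c u = u \<longleftrightarrow> (\<forall>x. Q0 u (x - c) = u x)" for c u
    by (auto simp: Qc_def shiftT_def fun_eq_iff)
  \<comment> \<open>The limits in hypothesis (v) are those of monotone functions, hence the infimum
    and supremum of the range.\<close>
  interpret propagating_bistable_map Q0 \<alpha>
  proof
    fix \<phi>\<^sub>1 \<phi>\<^sub>2 c\<^sub>1 c\<^sub>2
    assume 1: "\<phi>\<^sub>1 \<in> classM" "Qc c\<^sub>1 \<phi>\<^sub>1 = \<phi>\<^sub>1" "Inf (range \<phi>\<^sub>1) = 0" "Sup (range \<phi>\<^sub>1) = \<alpha>"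
      and 2: "\<phi>\<^sub>2 \<in> classM" "Qc c\<^sub>2 \<phi>\<^sub>2 = \<phi>\<^sub>2" "Inf (range \<phi>\<^sub>2) = \<alpha>" "Sup (range \<phi>\<^sub>2) = 1"
    show "c\<^sub>1 < c\<^sub>2"
      using hyp_v[rule_format, of \<phi>\<^sub>1 \<phi>\<^sub>2 c\<^sub>1 c\<^sub>2] 1 2 classM_tendsto_bot[OF 1(1)] classM_tendsto_top[OF 1(1)]
        classM_tendsto_bot[OF 2(1)] classM_tendsto_top[OF 2(1)] by (simp add: Qc_eq)
  qed
  have lo: "psi_lo \<le> Qc c_lo psi_lo" and hi: "Qc c_hi psi_hi \<le> psi_hi"
    using sub(4) super(4) by (auto simp: Qc_def shiftT_def le_fun_def)
  have "\<alpha> < Sup (range psi_lo)" "Inf (range psi_hi) < \<alpha>"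
    using sub(3) super(3) classM_Sup_eqI[OF sub(1)] classM_Inf_eqI[OF super(1)] by auto
  then obtain c u where "c \<in> {c_lo..c_hi}" and u: "u \<in> classM" "Inf (range u) = 0" "Sup (range u) = 1" "Qc c u = u"
    using bistable_wave_exists[OF sub(1,2) lo _ super(1,2) hi] by metis
  then show ?thesis
    using classM_tendsto_bot[OF u(1)] classM_tendsto_top[OF u(1)]
    by (intro bexI[of _ c] bexI[of _ u]) (simp_all add: Qc_eq)
qed

end
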